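(* Let $g\ge 3$ be an integer and let $G$ be a graph homeomorphic to the genus $g$ ladder graph. Then there exists a divisor $D$ on $G$ of degree $\lfloor (g+3)/2\rfloor$ and rank at least $1$.
   Context: A graph means a finite connected graph, possibly with loops and multiple edges; its genus is $|E(G)|-|V(G)|+1$. The genus $g$ ladder graph has vertices $x_1,\dots,x_{g-1}$ (bottom) and $y_1,\dots,y_{g-1}$ (top); edges $x_ix_{i+1}$ and $y_iy_{i+1}$ for $1\le i\le g-2$; one vertical edge $x_iy_i$ for each $2\le i\le g-2$; and two parallel edges between $x_1$ and $y_1$, and two parallel edges between $x_{g-1}$ and $y_{g-1}$. (So it has $g-3$ interior vertical edges, two end cycles and $g-2$ cells, and all vertices are trivalent.) A graph is homeomorphic to it if it is obtained from it by inserting arbitrarily many bivalent vertices on each of its edges. A divisor on $G$ is a formal $\mathbb{Z}$-linear combination $D=\sum_{v\in V(G)}D(v)\cdot v$; its degree is $\sum_v D(v)$; it is effective if $D(v)\ge 0$ for all $v$. Firing a vertex $v$ sends one chip from $v$ along each non-loop edge at $v$ to its other endpoint: for each $w\ne v$, $D(w)$ increases by the number of edges between $v$ and $w$, and $D(v)$ decreases by the total number of non-loop edges at $v$. Two divisors are linearly equivalent if they differ by a finite sequence of firing moves and their inverses. The class $[D]$ is effective if $D$ is equivalent to an effective divisor. The rank is $-1$ if $[D]$ is not effective, and otherwise it is the largest integer $k\ge 0$ such that $[D-E]$ is effective for every effective divisor $E$ of degree $k$. *)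

theory Defs
  imports Main
begin

section \<open>Finite connected multigraphs\<close>

text \<open>The set \<open>ends G e\<close> of endpoints of an edge has two elements, or one if \<open>e\<close> is a loop.\<close>

record ('v, 'e) mgraph =
  verts :: "'v set"
  edges :: "'e set"
  ends :: "'e \<Rightarrow> 'v set"

definition adjacent :: "('v, 'e) mgraph \<Rightarrow> 'v \<Rightarrow> 'v \<Rightarrow> bool" where
  "adjacent G u v \<longleftrightarrow> (\<exists>e\<in>edges G. ends G e = {u, v})"

locale multigraph =
  fixes G :: "('v, 'e) mgraph"
  assumes finite_verts: "finite (verts G)"
    and finite_edges: "finite (edges G)"
    and verts_nonempty: "verts G \<noteq> {}"
    and ends_in_verts: "e \<in> edges G \<Longrightarrow> ends G e \<subseteq> verts G"
    and card_ends: "e \<in> edges G \<Longrightarrow> card (ends G e) = 1 \<or> card (ends G e) = 2"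
    and connected: "u \<in> verts G \<Longrightarrow> v \<in> verts G \<Longrightarrow> (adjacent G)\<^sup>*\<^sup>* u v"

definition genus :: "('v, 'e) mgraph \<Rightarrow> int" where
  "genus G = int (card (edges G)) - int (card (verts G)) + 1"


section \<open>Subdivisions\<close>

text \<open>
  \<open>G\<close> arises from \<open>H\<close>, up to a renaming of vertices and edges, by inserting
  \<open>n e\<close> bivalent vertices on every edge \<open>e\<close> of \<open>H\<close>. The map \<open>\<phi>\<close> embeds the old
  vertices. The edge \<open>e\<close> becomes the path with vertices \<open>p e 0, \<dots>, p e (n e + 1)\<close>
  and edges \<open>q e 0, \<dots>, q e (n e)\<close>; the vertices \<open>p e 1, \<dots>, p e (n e)\<close> are new, and
  the path is closed if \<open>e\<close> is a loop.
\<close>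

definition is_subdivision :: "('w, 'f) mgraph \<Rightarrow> ('v, 'e) mgraph \<Rightarrow> bool" where
  "is_subdivision H G \<longleftrightarrow>
    (\<exists>(n :: 'f \<Rightarrow> nat) (\<phi> :: 'w \<Rightarrow> 'v) (p :: 'f \<Rightarrow> nat \<Rightarrow> 'v) (q :: 'f \<Rightarrow> nat \<Rightarrow> 'e).
      inj_on \<phi> (verts H) \<and>
      inj_on (\<lambda>(e, i). p e i) (SIGMA e:edges H. {1..n e}) \<and>
      \<phi> ` verts H \<inter> (\<lambda>(e, i). p e i) ` (SIGMA e:edges H. {1..n e}) = {} \<and>
      verts G = \<phi> ` verts H \<union> (\<lambda>(e, i). p e i) ` (SIGMA e:edges H. {1..n e}) \<and>
      bij_betw (\<lambda>(e, i). q e i) (SIGMA e:edges H. {0..n e}) (edges G) \<and>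
      (\<forall>e\<in>edges H. {p e 0, p e (n e + 1)} = \<phi> ` ends H e) \<and>
      (\<forall>e\<in>edges H. \<forall>i\<in>{0..n e}. ends G (q e i) = {p e i, p e (i + 1)}))"


section \<open>The ladder graph\<close>

text \<open>
  \<open>Bot i\<close> and \<open>Top i\<close> are the vertices \<open>x\<^sub>i\<close> and \<open>y\<^sub>i\<close>. The boolean argument of
  \<open>LeftEnd\<close> and \<open>RightEnd\<close> distinguishes the two parallel edges at each end.
\<close>

datatype ladder_vertex = Bot nat | Top nat

datatype ladder_edge = BotEdge nat | TopEdge nat | Rung nat | LeftEnd bool | RightEnd bool

fun ladder_ends :: "nat \<Rightarrow> ladder_edge \<Rightarrow> ladder_vertex set" where
  "ladder_ends g (BotEdge i) = {Bot i, Bot (i + 1)}"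
| "ladder_ends g (TopEdge i) = {Top i, Top (i + 1)}"
| "ladder_ends g (Rung i) = {Bot i, Top i}"
| "ladder_ends g (LeftEnd b) = {Bot 1, Top 1}"
| "ladder_ends g (RightEnd b) = {Bot (g - 1), Top (g - 1)}"

definition ladder :: "nat \<Rightarrow> (ladder_vertex, ladder_edge) mgraph" where
  "ladder g =
    \<lparr>verts = Bot ` {1..g - 1} \<union> Top ` {1..g - 1},
     edges = BotEdge ` {1..g - 2} \<union> TopEdge ` {1..g - 2} \<union> Rung ` {2..g - 2}
       \<union> range LeftEnd \<union> range RightEnd,
     ends = ladder_ends g\<rparr>"

lemma ladder_genus: "g \<ge> 3 \<Longrightarrow> genus (ladder g) = int g"
proof -
  assume g: "g \<ge> 3"
  have 1: "card (verts (ladder g)) = (g-1)+(g-1)"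
    unfolding ladder_def mgraph.simps
    by (subst card_Un_disjoint) (auto simp: card_image inj_on_def)
  have 2: "card (edges (ladder g)) = (g-2)+(g-2)+(g-3)+2+2"
    unfolding ladder_def mgraph.simps using g
    by (subst card_Un_disjoint; (simp add: card_image inj_on_def)?; blast?)+ (simp add: card_image inj_on_def, (auto)[1])?
  show ?thesis unfolding genus_def 1 2 using g by auto
qed


section \<open>Divisors and rank\<close>

text \<open>A divisor is represented by its coefficient function, which vanishes off the vertex set.\<close>

definition divisor :: "('v, 'e) mgraph \<Rightarrow> ('v \<Rightarrow> int) \<Rightarrow> bool" where
  "divisor G D \<longleftrightarrow> (\<forall>v. v \<notin> verts G \<longrightarrow> D v = 0)"

definition degree :: "('v, 'e) mgraph \<Rightarrow> ('v \<Rightarrow> int) \<Rightarrow> int" where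
  "degree G D = (\<Sum>v\<in>verts G. D v)"

definition effective :: "('v, 'e) mgraph \<Rightarrow> ('v \<Rightarrow> int) \<Rightarrow> bool" where
  "effective G D \<longleftrightarrow> (\<forall>v\<in>verts G. 0 \<le> D v)"

definition fire :: "('v, 'e) mgraph \<Rightarrow> 'v \<Rightarrow> ('v \<Rightarrow> int) \<Rightarrow> 'v \<Rightarrow> int" where
  "fire G v D = (\<lambda>w.
     if w = v then D v - int (card {e \<in> edges G. v \<in> ends G e \<and> ends G e \<noteq> {v}})
     else D w + int (card {e \<in> edges G. ends G e = {v, w}}))"

definition lin_equiv :: "('v, 'e) mgraph \<Rightarrow> ('v \<Rightarrow> int) \<Rightarrow> ('v \<Rightarrow> int) \<Rightarrow> bool" where
  "lin_equiv G = equivclp (\<lambda>D D'. \<exists>v\<in>verts G. D' = fire G v D)"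

definition effective_class :: "('v, 'e) mgraph \<Rightarrow> ('v \<Rightarrow> int) \<Rightarrow> bool" where
  "effective_class G D \<longleftrightarrow> (\<exists>D'. divisor G D' \<and> effective G D' \<and> lin_equiv G D D')"

text \<open>
  The maximum below exists for every divisor with effective class, because its degree
  bounds all admissible \<open>k\<close>.
\<close>

definition rank :: "('v, 'e) mgraph \<Rightarrow> ('v \<Rightarrow> int) \<Rightarrow> int" where
  "rank G D =
    (if \<not> effective_class G D then -1
     else int (GREATEST k. \<forall>E. divisor G E \<and> effective G E \<and> degree G E = int k
                 \<longrightarrow> effective_class G (\<lambda>v. D v - E v)))"

end

theory Submission
  imports Defs "HOL-Library.Multiset"
begin

text \<open>
  Call the pair of vertices \<open>x\<^sub>i\<close>, \<open>y\<^sub>i\<close> the column \<open>i\<close>. Along a subdivided edge the class of the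
  vertex at distance \<open>i\<close> from an end depends affinely on \<open>i\<close>, so two chips on an edge cover all of
  the edge between them; in particular a pair of chips on a column covers its vertical edges. If a cut
  of the ladder has a chip on each of its edges, all these chips can move across it at equal speed.

  One spare chip, placed according to the edge lengths, carries a pair of chips from column \<open>i\<close> to
  column \<open>i + 2\<close> and thereby reaches every vertex in between. With \<open>\<lfloor>(g - 1) / 2\<rfloor>\<close> spare chips the
  pair travels from column \<open>1\<close> to column \<open>g - 1\<close>, the last spare chip serving a single cell if \<open>g\<close> is
  odd. This makes \<open>2 + \<lfloor>(g - 1) / 2\<rfloor> = \<lfloor>(g + 3) / 2\<rfloor>\<close> chips in total.
\<close>

section \<open>Chip firing\<close>

definition chips :: "'v multiset \<Rightarrow> 'v \<Rightarrow> int" where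
  "chips M v = int (count M v)"

lemma chips_simps [simp]:
  "chips {#} v = 0"
  "chips (add_mset x M) v = chips M v + of_bool (x = v)"
  "chips (M + N) v = chips M v + chips N v"
  by (auto simp: chips_def)

lemma chips_image_mset_set:
  assumes "finite I"
  shows "chips (image_mset f (mset_set I)) v = (\<Sum>i\<in>I. of_bool (f i = v))"
  using assms by induction auto

definition chip_equiv :: "('v, 'e) mgraph \<Rightarrow> 'v multiset \<Rightarrow> 'v multiset \<Rightarrow> bool" where
  "chip_equiv G M N \<longleftrightarrow> lin_equiv G (chips M) (chips N)"

lemma lin_equiv_refl: "lin_equiv G D D"
  by (simp add: lin_equiv_def)

lemma lin_equiv_sym: "lin_equiv G D D' \<Longrightarrow> lin_equiv G D' D"
  unfolding lin_equiv_def by (rule equivclp_sym)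

lemma lin_equiv_trans: "lin_equiv G D D' \<Longrightarrow> lin_equiv G D' D'' \<Longrightarrow> lin_equiv G D D''"
  unfolding lin_equiv_def by (rule equivclp_trans)

text \<open>An inverse firing is a firing read backwards, so invariance under one firing of an
  arbitrary divisor suffices.\<close>

lemma lin_equiv_invariant:
  assumes "lin_equiv G D D'" and "\<And>D v. v \<in> verts G \<Longrightarrow> h (fire G v D) = h D"
  shows "h D = h D'"
  using assms(1) unfolding lin_equiv_def
  by (induction rule: equivclp_induct) (auto simp: assms(2))

text \<open>The change made by a firing does not depend on the divisor to which it is
  applied.\<close>

lemma lin_equiv_translate:
  assumes "lin_equiv G D D'"
  shows "lin_equiv G (\<lambda>v. D v + E v) (\<lambda>v. D' v + E v)"
  using assms unfolding lin_equiv_def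
proof (induction rule: equivclp_induct)
  case base
  show ?case by simp
next
  case (step y z)
  have fire_add: "(\<lambda>w. fire G v D w + E w) = fire G v (\<lambda>w. D w + E w)" for v D
    by (auto simp: fire_def)
  have "equivclp (\<lambda>D D'. \<exists>v\<in>verts G. D' = fire G v D) (\<lambda>v. y v + E v) (\<lambda>v. z v + E v)"
    using step(2)
  proof
    assume "\<exists>v\<in>verts G. z = fire G v y"
    then show ?thesis by (intro r_into_equivclp) (auto simp: fire_add)
  next
    assume "\<exists>v\<in>verts G. y = fire G v z"
    then show ?thesis by (intro equivclp_sym[OF r_into_equivclp]) (auto simp: fire_add)
  qed
  with step(3) show ?case by (rule equivclp_trans)
qed

lemma chip_equiv_refl [simp, intro]: "chip_equiv G M M"
  by (simp add: chip_equiv_def lin_equiv_refl)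

lemma chip_equiv_sym: "chip_equiv G M N \<Longrightarrow> chip_equiv G N M"
  by (simp add: chip_equiv_def lin_equiv_sym)

lemma chip_equiv_trans [trans]: "chip_equiv G M N \<Longrightarrow> chip_equiv G N K \<Longrightarrow> chip_equiv G M K"
  unfolding chip_equiv_def by (rule lin_equiv_trans)

text \<open>Cancellation is translation by the negative of \<open>chips K\<close>, in general not a
  chip configuration itself. It permits proofs that add auxiliary chips and remove them at the
  end.\<close>

lemma chip_equiv_add_right_iff [simp]: "chip_equiv G (M + K) (N + K) \<longleftrightarrow> chip_equiv G M N"
proof
  assume "chip_equiv G (M + K) (N + K)"
  from lin_equiv_translate[OF this[unfolded chip_equiv_def], of "\<lambda>v. - chips K v"]
  show "chip_equiv G M N" by (simp add: chip_equiv_def)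
next
  assume "chip_equiv G M N"
  from lin_equiv_translate[OF this[unfolded chip_equiv_def], of "chips K"]
   show "chip_equiv G (M + K) (N + K)" by (simp add: chip_equiv_def flip: chips_simps(3))
qed

lemma chip_equiv_add_mset_iff [simp]:
  "chip_equiv G (add_mset x M) (add_mset x N) \<longleftrightarrow> chip_equiv G M N"
  using chip_equiv_add_right_iff[of G M "{#x#}" N] by simp

lemma chip_equiv_spare: "chip_equiv G {#x, y#} {#x', y'#} \<Longrightarrow> chip_equiv G {#x, y, z#} {#x', y', z#}"
  using chip_equiv_add_right_iff[of G "{#x, y#}" "{#z#}" "{#x', y'#}"] by (simp add: add_mset_commute)

lemma chip_equiv_add: "chip_equiv G M N \<Longrightarrow> chip_equiv G M' N' \<Longrightarrow> chip_equiv G (M + M') (N + N')"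
  by (metis add.commute chip_equiv_add_right_iff chip_equiv_trans)

lemma chip_equiv_image_mset:
  assumes "finite I" and "\<And>i. i \<in> I \<Longrightarrow> chip_equiv G {#f i, g i#} {#f' i, g' i#}"
  shows "chip_equiv G (image_mset f (mset_set I) + image_mset g (mset_set I))
    (image_mset f' (mset_set I) + image_mset g' (mset_set I))"
  using assms
proof (induction I)
  case (insert i I)
  then show ?case
    using chip_equiv_add[of G "{#f i, g i#}" "{#f' i, g' i#}"] by (simp add: add_mset_commute)
qed simp

text \<open>\<open>N\<close> is the effective remainder after one chip is taken from
  \<open>v\<close>. If this succeeds at every vertex, the rank is at least one.\<close>

definition covers :: "('v, 'e) mgraph \<Rightarrow> 'v multiset \<Rightarrow> 'v \<Rightarrow> bool" where
  "covers G M v \<longleftrightarrow> (\<exists>N. chip_equiv G M (add_mset v N))"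

lemma coversI: "chip_equiv G M N \<Longrightarrow> v \<in># N \<Longrightarrow> covers G M v"
  unfolding covers_def by (metis insert_DiffM)

lemma covers_cong: "chip_equiv G M N \<Longrightarrow> covers G N v \<Longrightarrow> covers G M v"
  unfolding covers_def using chip_equiv_trans by blast

lemma covers_add: "covers G M v \<Longrightarrow> covers G (M + K) v"
  unfolding covers_def by (metis chip_equiv_add_right_iff union_mset_add_mset_left)

section \<open>Firing a set of vertices across its edge cut\<close>

context multigraph
begin

text \<open>Contribution of the single edge \<open>e\<close> to the change at \<open>w\<close> when
  \<open>v\<close> is fired, zero for loops. With it, the effect of firing a whole set of vertices
  can be summed edge by edge.\<close>

definition flow :: "'e \<Rightarrow> 'v \<Rightarrow> 'v \<Rightarrow> int" where
  "flow e v w =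
    (if v \<in> ends G e \<and> ends G e \<noteq> {v} \<and> w \<in> ends G e then (if w = v then -1 else 1) else 0)"

lemma fire_eq: "fire G v D w = D w + (\<Sum>e\<in>edges G. flow e v w)"
proof (cases "w = v")
  case True
  have "(\<Sum>e\<in>edges G. flow e v v)
      = (\<Sum>e\<in>edges G. if v \<in> ends G e \<and> ends G e \<noteq> {v} then -1 else 0)"
    by (intro sum.cong) (auto simp: flow_def)
  also have "\<dots> = (\<Sum>e\<in>{e \<in> edges G. v \<in> ends G e \<and> ends G e \<noteq> {v}}. -1)"
    using finite_edges by (intro sum.inter_filter[symmetric])
  finally show ?thesis using True by (simp add: fire_def)
next
  case False
  have eq: "v \<in> ends G e \<and> ends G e \<noteq> {v} \<and> w \<in> ends G e \<longleftrightarrow> ends G e = {v, w}"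
    if "e \<in> edges G" for e
    using card_ends[OF that] False by (auto simp: card_1_singleton_iff card_2_iff)
  have "(\<Sum>e\<in>edges G. flow e v w) = (\<Sum>e\<in>edges G. if ends G e = {v, w} then 1 else 0)"
    using False by (intro sum.cong) (auto simp: flow_def eq)
  also have "\<dots> = (\<Sum>e\<in>{e \<in> edges G. ends G e = {v, w}}. 1)"
    using finite_edges by (intro sum.inter_filter[symmetric])
  finally show ?thesis using False by (simp add: fire_def)
qed

lemma lin_equiv_fire_set:
  assumes "finite W" "W \<subseteq> verts G"
  shows "lin_equiv G D (\<lambda>w. D w + (\<Sum>v\<in>W. \<Sum>e\<in>edges G. flow e v w))"
  using assms
proof (induction W)
  case empty
  show ?case by (simp add: lin_equiv_refl)
next
  case (insert v W)
  let ?D = "\<lambda>w. D w + (\<Sum>v\<in>W. \<Sum>e\<in>edges G. flow e v w)"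
  have "lin_equiv G ?D (fire G v ?D)"
    unfolding lin_equiv_def using insert by (intro r_into_equivclp) auto
  also have "fire G v ?D = (\<lambda>w. D w + (\<Sum>v\<in>insert v W. \<Sum>e\<in>edges G. flow e v w))"
    using insert by (auto simp: fire_eq)
  finally show ?case
    using insert lin_equiv_trans by blast
qed

lemma sum_flow:
  assumes "finite W"
  shows "(\<Sum>v\<in>W. flow e v w) = (\<Sum>v\<in>W \<inter> ends G e. flow e v w)"
  using assms by (intro sum.mono_neutral_right) (auto simp: flow_def)

text \<open>All of \<open>W\<close> is fired. An edge inside \<open>W\<close> carries one chip in
  each direction and an edge outside carries none, so exactly the cut edges move a chip, from
  \<open>s i\<close> to \<open>t i\<close>. The map \<open>c\<close> lists the cut edges without
  repetition, whereas \<open>s\<close> and \<open>t\<close> may take a value several times.\<close>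

lemma fire_cut:
  assumes W: "W \<subseteq> verts G" and I: "finite I" "inj_on c I"
    and cut: "{e \<in> edges G. ends G e \<inter> W \<noteq> {} \<and> \<not> ends G e \<subseteq> W} = c ` I"
    and ends: "\<And>i. i \<in> I \<Longrightarrow> ends G (c i) = {s i, t i} \<and> s i \<in> W \<and> t i \<notin> W"
  shows "chip_equiv G (image_mset s (mset_set I)) (image_mset t (mset_set I))"
proof -
  have fW: "finite W" using W finite_verts finite_subset by blast
  have out: "(\<Sum>v\<in>W. flow e v w) = 0" if e: "e \<in> edges G - c ` I" for e w
  proof (cases "ends G e \<inter> W = {}")
    case True
    then show ?thesis using e by (subst sum_flow[OF fW]) (auto simp: Int_commute)
  next
    case False
    then have sub: "ends G e \<subseteq> W" using that cut by blast
    show ?thesis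
    proof (cases "card (ends G e) = 1")
      case True
      then show ?thesis
        by (intro sum.neutral) (auto simp: flow_def card_1_singleton_iff)
    next
      case False
      then obtain a b where ab: "ends G e = {a, b}" "a \<noteq> b"
        using card_ends[of e] e unfolding card_2_iff by blast
      have "W \<inter> {a, b} = {a, b}" using sub ab by auto
      then show ?thesis using ab e by (subst sum_flow[OF fW]) (auto simp: flow_def)
    qed
  qed
  have crossing: "(\<Sum>v\<in>W. flow (c i) v w) = of_bool (t i = w) - of_bool (s i = w)"
    if "i \<in> I" for i w
  proof -
    have "c i \<in> edges G" using that cut by blast
    moreover have "W \<inter> ends G (c i) = {s i}" "s i \<noteq> t i" using ends[OF that] by auto
    ultimately show ?thesis
      using ends[OF that] by (subst sum_flow[OF fW]) (auto simp: flow_def)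
  qed
  have "(\<Sum>v\<in>W. \<Sum>e\<in>edges G. flow e v w)
      = (\<Sum>i\<in>I. of_bool (t i = w)) - (\<Sum>i\<in>I. of_bool (s i = w))" for w
  proof -
    have sub: "c ` I \<subseteq> edges G" using cut by blast
    have "(\<Sum>v\<in>W. \<Sum>e\<in>edges G. flow e v w) = (\<Sum>e\<in>edges G. \<Sum>v\<in>W. flow e v w)"
      by (rule sum.swap)
    also have "\<dots> = (\<Sum>e\<in>c ` I. \<Sum>v\<in>W. flow e v w)"
      by (rule sum.mono_neutral_right) (use finite_edges sub out in auto)
    also have "\<dots> = (\<Sum>i\<in>I. of_bool (t i = w) - of_bool (s i = w))"
      by (simp add: sum.reindex[OF I(2)] crossing)
    finally show ?thesis by (simp add: sum_subtractf)
  qed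
  with lin_equiv_fire_set[OF fW W, of "chips (image_mset s (mset_set I))"]
  have "lin_equiv G (chips (image_mset s (mset_set I))) (\<lambda>w. chips (image_mset t (mset_set I)) w)"
    by (simp add: chips_image_mset_set I)
  then show ?thesis by (simp add: chip_equiv_def)
qed

section \<open>Invariants of linear equivalence\<close>

lemma lin_equiv_outside:
  assumes "lin_equiv G D D'" "w \<notin> verts G"
  shows "D w = D' w"
proof (rule lin_equiv_invariant[OF assms(1), of "\<lambda>D. D w"])
  show "fire G v D w = D w" for D v
  proof -
    have "flow e v w = 0" if "e \<in> edges G" for e
      using ends_in_verts[OF that] assms(2) by (auto simp: flow_def)
    then show ?thesis by (simp add: fire_eq)
  qed
qed

text \<open>Each non-loop edge at the fired vertex takes one chip from it and gives one to the other
  end, so the flows of every edge cancel.\<close>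

lemma lin_equiv_degree:
  assumes "lin_equiv G D D'"
  shows "degree G D = degree G D'"
proof (rule lin_equiv_invariant[OF assms(1), of "degree G"])
  show "degree G (fire G v D) = degree G D" for D v
  proof -
    have "(\<Sum>w\<in>verts G. flow e v w) = 0" if e: "e \<in> edges G" for e
    proof (cases "v \<in> ends G e \<and> ends G e \<noteq> {v}")
      case True
      then have "card (ends G e) = 2" using card_ends[OF e] by (auto simp: card_1_singleton_iff)
      then obtain a b where "ends G e = {a, b}" "a \<noteq> b" by (auto simp: card_2_iff)
      then obtain u where u: "ends G e = {v, u}" "u \<noteq> v"
        using True that[of a] that[of b] by auto
      have "(\<Sum>w\<in>verts G. flow e v w) = (\<Sum>w\<in>{v, u}. flow e v w)"
        using ends_in_verts[OF e] u finite_verts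
        by (intro sum.mono_neutral_right) (auto simp: flow_def)
      then show ?thesis using u by (simp add: flow_def)
    qed (auto simp: flow_def)
    then have "(\<Sum>w\<in>verts G. \<Sum>e\<in>edges G. flow e v w) = 0"
      by (subst sum.swap) simp
    then show ?thesis by (simp add: degree_def fire_eq sum.distrib)
  qed
qed

text \<open>Firing changes nothing outside the vertex set. This locates the chip left behind by a
  crossing, which is known only through an equivalence.\<close>

lemma chip_equiv_verts:
  assumes "chip_equiv G M N" "set_mset M \<subseteq> verts G"
  shows "set_mset N \<subseteq> verts G"
proof
  fix w assume w: "w \<in># N"
  show "w \<in> verts G"
  proof (rule ccontr)
    assume "w \<notin> verts G"
    moreover from this have "count M w = 0"
      using assms(2) by (meson count_eq_zero_iff subsetD)
    ultimately have "count N w = 0"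
      using lin_equiv_outside[OF assms(1)[unfolded chip_equiv_def], of w] by (simp add: chips_def)
    then show False using w by (simp add: count_eq_zero_iff)
  qed
qed

lemma degree_chips:
  assumes "set_mset M \<subseteq> verts G"
  shows "degree G (chips M) = int (size M)"
proof -
  have "degree G (chips M) = (\<Sum>v\<in>set_mset M. chips M v)"
    unfolding degree_def using assms finite_verts
    by (intro sum.mono_neutral_right) (auto simp: chips_def count_eq_zero_iff)
  then show ?thesis by (simp add: chips_def size_multiset_overloaded_eq)
qed

section \<open>A criterion for rank at least one\<close>

lemma degree_diff: "degree G (\<lambda>v. D v - E v) = degree G D - degree G E"
  by (simp add: degree_def sum_subtractf)

lemma degree_one_unit:
  assumes "divisor G E" "effective G E" "degree G E = 1"
  obtains v where "v \<in> verts G" "E = chips {#v#}"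
proof -
  have "\<exists>v\<in>verts G. E v > 0"
    using assms by (metis degree_def effective_def order_le_less sum.neutral zero_neq_one)
  then obtain v where v: "v \<in> verts G" "E v > 0" by blast
  have "1 = E v + (\<Sum>w\<in>verts G - {v}. E w)"
    using assms(3) v(1) finite_verts by (simp add: degree_def sum.remove)
  moreover have nn: "\<forall>w\<in>verts G - {v}. 0 \<le> E w" using assms(2) by (auto simp: effective_def)
  ultimately have one: "E v = 1" and zero: "(\<Sum>w\<in>verts G - {v}. E w) = 0"
    using v(2) sum_nonneg[of "verts G - {v}" E] by auto
  have "E w = 0" if "w \<noteq> v" for w
  proof (cases "w \<in> verts G")
    case True
    then show ?thesis
      using that sum_nonneg_0[of "verts G - {v}" E w] zero nn finite_verts by auto
  qed (use assms(1) in \<open>auto simp: divisor_def\<close>)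
  with one have "E = chips {#v#}" by (auto simp: fun_eq_iff)
  with v(1) show thesis by (rule that)
qed

text \<open>An effective divisor of degree one is a single chip, so the covering hypothesis makes
  \<open>k = 1\<close> admissible. For \<open>GREATEST\<close> to be at least this value the
  admissible \<open>k\<close> must be bounded: testing with \<open>k\<close> chips on one vertex and
  comparing degrees gives \<open>k \<le> size M\<close>.\<close>

lemma rank_ge_one:
  assumes M: "set_mset M \<subseteq> verts G" and cov: "\<And>v. v \<in> verts G \<Longrightarrow> covers G M v"
  shows "rank G (chips M) \<ge> 1"
proof -
  have div: "divisor G (chips M)"
    using M by (auto simp: divisor_def chips_def count_eq_zero_iff)
  have "effective_class G (chips M)"
    unfolding effective_class_def using div lin_equiv_refl
    by (intro exI[of _ "chips M"]) (auto simp: effective_def chips_def)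
  moreover define P where "P k \<longleftrightarrow> (\<forall>E. divisor G E \<and> effective G E \<and> degree G E = int k
      \<longrightarrow> effective_class G (\<lambda>v. chips M v - E v))" for k
  have "P 1"
    unfolding P_def
  proof (intro allI impI)
    fix E assume "divisor G E \<and> effective G E \<and> degree G E = int 1"
    then obtain v where v: "v \<in> verts G" "E = chips {#v#}"
      using degree_one_unit[of E] by auto
    obtain N where N: "chip_equiv G M (add_mset v N)"
      using cov[OF v(1)] by (auto simp: covers_def)
    have "lin_equiv G (\<lambda>w. chips M w + - E w) (\<lambda>w. chips (add_mset v N) w + - E w)"
      using lin_equiv_translate[OF N[unfolded chip_equiv_def]] .
    then have "lin_equiv G (\<lambda>w. chips M w - E w) (\<lambda>w. chips N w)"
      using v(2) by simp
    moreover have "divisor G (chips N)"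
      unfolding divisor_def
    proof (intro allI impI)
      fix w assume "w \<notin> verts G"
      then have "chips (add_mset v N) w = 0"
        using N div lin_equiv_outside unfolding chip_equiv_def divisor_def by metis
      then show "chips N w = 0" by (simp add: chips_def split: if_splits)
    qed
    ultimately show "effective_class G (\<lambda>v. chips M v - E v)"
      unfolding effective_class_def
      by (intro exI[of _ "chips N"]) (simp add: effective_def, simp add: chips_def)
  qed
  moreover have "k \<le> size M" if "P k" for k
  proof -
    obtain v where v: "v \<in> verts G" using verts_nonempty by blast
    let ?E = "chips (replicate_mset k v)"
    have E: "degree G ?E = int k"
      using v by (subst degree_chips) auto
    moreover have "divisor G ?E" "effective G ?E"
      using v by (auto simp: divisor_def effective_def chips_def)
    ultimately obtain D' where "effective G D'" "lin_equiv G (\<lambda>v. chips M v - ?E v) D'"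
      using \<open>P k\<close> unfolding P_def effective_class_def by blast
    then have "0 \<le> degree G (\<lambda>v. chips M v - ?E v)"
      by (simp add: lin_equiv_degree) (simp add: degree_def effective_def sum_nonneg)
    then show ?thesis by (simp add: degree_diff E degree_chips[OF M])
  qed
  then have "1 \<le> (GREATEST k. P k)" using \<open>P 1\<close> by (metis Greatest_le_nat)
  ultimately show ?thesis unfolding rank_def P_def by simp
qed

end

section \<open>Subdivided edges\<close>

text \<open>Encodes that the difference of the classes of \<open>c (i + 1)\<close> and
  \<open>c i\<close> is the same for all \<open>i < L\<close>. Written as a move of two chips in
  opposite directions, it involves only effective configurations.\<close>

definition affine_chain :: "('v, 'e) mgraph \<Rightarrow> (nat \<Rightarrow> 'v) \<Rightarrow> nat \<Rightarrow> bool" where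
  "affine_chain G c L \<longleftrightarrow> (\<forall>a b a' b'. a \<le> L \<longrightarrow> b \<le> L \<longrightarrow> a' \<le> L \<longrightarrow> b' \<le> L \<longrightarrow>
    a + b = a' + b' \<longrightarrow> chip_equiv G {#c a, c b#} {#c a', c b'#})"

lemma affine_chainD:
  "affine_chain G c L \<Longrightarrow> a \<le> L \<Longrightarrow> b \<le> L \<Longrightarrow> a' \<le> L \<Longrightarrow> b' \<le> L \<Longrightarrow> a + b = a' + b' \<Longrightarrow>
    chip_equiv G {#c a, c b#} {#c a', c b'#}"
  unfolding affine_chain_def by blast

text \<open>The hypothesis says that second differences vanish. Induction on the distance makes all
  unit moves equivalent (\<open>step_le\<close>, \<open>step\<close>), and \<open>shift\<close>
  repeats them \<open>d\<close> times.\<close>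

lemma affine_chainI:
  assumes "\<And>i. 0 < i \<Longrightarrow> i < L \<Longrightarrow> chip_equiv G {#c i, c i#} {#c (i - 1), c (i + 1)#}"
  shows "affine_chain G c L"
proof -
  have step_le: "chip_equiv G {#c j, c (Suc k)#} {#c (Suc j), c k#}" if "j \<le> k" "k < L" for j k
    using that
  proof (induction k rule: dec_induct)
    case base
    then show ?case by (simp add: add_mset_commute)
  next
    case (step k)
    \<comment> \<open>An auxiliary chip on \<open>c k\<close> is added: it is first moved together
      with the chip on \<open>c (Suc (Suc k))\<close> to \<open>c (Suc k)\<close>, and a chip on
      \<open>c k\<close> is cancelled at the end.\<close>
    have "chip_equiv G ({#c j#} + {#c k, c (Suc (Suc k))#}) ({#c j#} + {#c (Suc k), c (Suc k)#})"
      using assms[of "Suc k"] step.prems by (intro chip_equiv_add) (auto intro: chip_equiv_sym)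
    also have "chip_equiv G \<dots> ({#c (Suc k)#} + {#c (Suc j), c k#})"
      using chip_equiv_add[OF chip_equiv_refl step.IH, of "{#c (Suc k)#}"] step.prems
      by (simp add: add_mset_commute)
    finally have "chip_equiv G (add_mset (c k) {#c j, c (Suc (Suc k))#})
        (add_mset (c k) {#c (Suc j), c (Suc k)#})"
      by (simp add: add_mset_commute)
    then show ?case by simp
  qed
  have step: "chip_equiv G {#c j, c (Suc k)#} {#c (Suc j), c k#}" if "j < L" "k < L" for j k
  proof (cases "j \<le> k")
    case False
    then show ?thesis
      using step_le[of k j] that by (simp add: chip_equiv_sym add_mset_commute)
  qed (use step_le that in auto)
  have shift: "chip_equiv G {#c a, c (b + d)#} {#c (a + d), c b#}"
    if "a + d \<le> L" "b + d \<le> L" for a b d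
    using that
  proof (induction d arbitrary: b)
    case (Suc d)
    have "chip_equiv G {#c a, c (Suc b + d)#} {#c (a + d), c (Suc b)#}"
      using Suc.prems by (intro Suc.IH) auto
    also have "chip_equiv G \<dots> {#c (Suc (a + d)), c b#}"
      using Suc.prems by (intro step) auto
    finally show ?case by simp
  qed simp
  show ?thesis
    unfolding affine_chain_def
  proof (intro allI impI)
    fix a b a' b' :: nat
    assume *: "a \<le> L" "b \<le> L" "a' \<le> L" "b' \<le> L" "a + b = a' + b'"
    show "chip_equiv G {#c a, c b#} {#c a', c b'#}"
    proof (cases "a \<le> a'")
      case True
      moreover have "b = b' + (a' - a)" using True * by simp
      ultimately show ?thesis using shift[of a "a' - a" b'] * by simp
    next
      case False
      moreover have "b' = b + (a - a')" using False * by simp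
      ultimately show ?thesis using shift[of a' "a - a'" b] * by (simp add: chip_equiv_sym)
    qed
  qed
qed

text \<open>The witnesses of \<open>is_subdivision\<close> are fixed. Since \<open>H\<close> has no
  loops, the two ends of every subdivided edge differ, so a starting vertex determines a
  direction.\<close>

locale subdivision = multigraph G
  for G :: "('v, 'e) mgraph" +
  fixes H :: "('w, 'f) mgraph" and n :: "'f \<Rightarrow> nat" and \<phi> :: "'w \<Rightarrow> 'v"
    and p :: "'f \<Rightarrow> nat \<Rightarrow> 'v" and q :: "'f \<Rightarrow> nat \<Rightarrow> 'e"
  assumes finite_edges_H: "finite (edges H)"
    and loopless: "e \<in> edges H \<Longrightarrow> card (ends H e) = 2"
    and ends_H: "e \<in> edges H \<Longrightarrow> ends H e \<subseteq> verts H"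
    and inj_\<phi>: "inj_on \<phi> (verts H)"
    and inj_p: "inj_on (\<lambda>(e, i). p e i) (SIGMA e:edges H. {1..n e})"
    and disjoint: "\<phi> ` verts H \<inter> (\<lambda>(e, i). p e i) ` (SIGMA e:edges H. {1..n e}) = {}"
    and verts_G: "verts G = \<phi> ` verts H \<union> (\<lambda>(e, i). p e i) ` (SIGMA e:edges H. {1..n e})"
    and bij_q: "bij_betw (\<lambda>(e, i). q e i) (SIGMA e:edges H. {0..n e}) (edges G)"
    and p_ends: "e \<in> edges H \<Longrightarrow> {p e 0, p e (n e + 1)} = \<phi> ` ends H e"
    and q_ends: "e \<in> edges H \<Longrightarrow> i \<in> {0..n e} \<Longrightarrow> ends G (q e i) = {p e i, p e (i + 1)}"
begin

definition len :: "'f \<Rightarrow> nat" where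
  "len e = n e + 1"

text \<open>The statement does not fix in which direction \<open>p e\<close> runs through \<open>e\<close>; \<open>arc a e\<close> starts at \<open>a\<close>.\<close>

definition arc :: "'w \<Rightarrow> 'f \<Rightarrow> nat \<Rightarrow> 'v" where
  "arc a e i = (if p e 0 = \<phi> a then p e i else p e (len e - i))"

text \<open>Reversal sends edge index \<open>i\<close> to \<open>n e - i\<close> but vertex index
  \<open>i\<close> to \<open>len e - i\<close>, because a path has one vertex more than
  edges.\<close>

definition arc_edge :: "'w \<Rightarrow> 'f \<Rightarrow> nat \<Rightarrow> 'e" where
  "arc_edge a e i = (if p e 0 = \<phi> a then q e i else q e (n e - i))"

section \<open>Incidences along subdivided edges\<close>

lemma interior_inj:
  assumes "e \<in> edges H" "i \<in> {1..n e}" "e' \<in> edges H" "i' \<in> {1..n e'}" "p e i = p e' i'"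
  shows "e = e'" "i = i'"
  using inj_onD[OF inj_p, of "(e, i)" "(e', i')"] assms by auto

lemma interior_not_\<phi>:
  assumes "e \<in> edges H" "i \<in> {1..n e}" "w \<in> verts H"
  shows "p e i \<noteq> \<phi> w"
  using disjoint assms by fastforce

lemma q_inj:
  assumes "e \<in> edges H" "i \<le> n e" "e' \<in> edges H" "i' \<le> n e'" "q e i = q e' i'"
  shows "e = e'" "i = i'"
  using inj_onD[OF bij_betw_imp_inj_on[OF bij_q], of "(e, i)" "(e', i')"] assms by auto

lemma edges_G: "edges G = (\<lambda>(e, i). q e i) ` (SIGMA e:edges H. {0..n e})"
  using bij_q by (simp add: bij_betw_def)

lemma p_eq_interior:
  assumes "e \<in> edges H" "i \<le> n e + 1" "e0 \<in> edges H" "i0 \<in> {1..n e0}" "p e i = p e0 i0"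
  shows "e = e0 \<and> i = i0"
proof (cases "i \<in> {1..n e}")
  case True
  then show ?thesis using interior_inj[of e i e0 i0] assms by auto
next
  case False
  then have "i = 0 \<or> i = n e + 1" using assms(2) by auto
  then have "p e i \<in> \<phi> ` ends H e" using p_ends[OF assms(1)] by auto
  then show ?thesis using interior_not_\<phi>[of e0 i0] ends_H assms by fastforce
qed

lemma arc_props:
  assumes e: "e \<in> edges H" and ab: "ends H e = {a, b}" "a \<noteq> b"
  shows arc_0: "arc a e 0 = \<phi> a"
    and arc_len: "arc a e (len e) = \<phi> b"
    and arc_rev: "i \<le> len e \<Longrightarrow> arc b e i = arc a e (len e - i)"
proof -
  have "\<phi> a \<noteq> \<phi> b" using inj_onD[OF inj_\<phi>, of a b] ends_H[OF e] ab by auto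
  moreover have "{p e 0, p e (n e + 1)} = {\<phi> a, \<phi> b}" using p_ends[OF e] ab by simp
  ultimately have *: "p e 0 = \<phi> a \<and> p e (n e + 1) = \<phi> b \<or> p e 0 = \<phi> b \<and> p e (n e + 1) = \<phi> a"
    by (auto simp: doubleton_eq_iff)
  with \<open>\<phi> a \<noteq> \<phi> b\<close> show "arc a e 0 = \<phi> a" "arc a e (len e) = \<phi> b"
    and "i \<le> len e \<Longrightarrow> arc b e i = arc a e (len e - i)"
    by (auto simp: arc_def len_def)
qed

lemma other_end:
  assumes "e \<in> edges H" "a \<in> ends H e"
  obtains b where "ends H e = {a, b}" "a \<noteq> b"
proof -
  obtain x y where xy: "ends H e = {x, y}" "x \<noteq> y"
    using loopless[OF assms(1)] by (auto simp: card_2_iff)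
  show thesis
  proof (cases "a = x")
    case False
    then show thesis using that[of x] xy assms(2) by auto
  qed (use that[of y] xy in auto)
qed

text \<open>Reversing the direction swaps the two neighbours, hence they appear as an unordered
  pair. This transfers statements about \<open>p\<close> to arcs of either direction.\<close>

lemma arc_interior:
  assumes "0 < i" "i < len e"
  obtains j where "j \<in> {1..n e}" "arc a e i = p e j"
    "{arc a e (i - 1), arc a e (i + 1)} = {p e (j - 1), p e (j + 1)}"
proof (cases "p e 0 = \<phi> a")
  case True
  then show thesis using that[of i] assms by (auto simp: arc_def len_def)
next
  case False
  have "len e - (i - 1) = len e - i + 1" "len e - (i + 1) = len e - i - 1"
    using assms by auto
  with False have "arc a e (i - 1) = p e (len e - i + 1)" "arc a e (i + 1) = p e (len e - i - 1)"
    by (simp_all only: arc_def if_False)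
  moreover have "len e - i \<in> {1..n e}" "arc a e i = p e (len e - i)"
    using assms False by (auto simp: len_def arc_def)
  ultimately show thesis using that[of "len e - i"] by (simp add: insert_commute)
qed

lemma ends_arc_edge:
  assumes "e \<in> edges H" "i < len e"
  shows "arc_edge a e i \<in> edges G" "ends G (arc_edge a e i) = {arc a e i, arc a e (i + 1)}"
  using assms q_ends[of e i] q_ends[of e "n e - i"]
  by (auto simp: arc_edge_def arc_def len_def edges_G Suc_diff_le)

lemma q_eq_arc_edge:
  assumes "i \<le> n e"
  obtains j where "j < len e" "q e i = arc_edge a e j"
proof (cases "p e 0 = \<phi> a")
  case True
  then show thesis using that[of i] assms by (auto simp: arc_edge_def len_def)
next
  case False
  then show thesis using that[of "n e - i"] assms by (auto simp: arc_edge_def len_def)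
qed

lemma arc_edge_inj:
  assumes "e \<in> edges H" "e' \<in> edges H" "i < len e" "i' < len e'" "arc_edge a e i = arc_edge a' e' i'"
  shows "e = e'"
proof -
  have "\<exists>k\<le>n e. arc_edge a e i = q e k" if "i < len e" for a e i
    using q_eq_arc_edge that by (auto simp: arc_edge_def len_def intro: exI[of _ i] exI[of _ "n e - i"])
  then show ?thesis using assms q_inj(1) by metis
qed

lemma covered_by_arc:
  assumes "v \<in> verts G" and "\<And>w. w \<in> verts H \<Longrightarrow> \<exists>e\<in>edges H. w \<in> ends H e"
  obtains e a i where "e \<in> edges H" "a \<in> ends H e" "i \<le> len e" "v = arc a e i"
proof -
  consider w where "w \<in> verts H" "v = \<phi> w" | e i where "e \<in> edges H" "i \<in> {1..n e}" "v = p e i"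
    using assms(1) verts_G by auto
  then show thesis
  proof cases
    case 1
    then obtain e where e: "e \<in> edges H" "w \<in> ends H e" using assms(2) by blast
    then obtain b where "ends H e = {w, b}" "w \<noteq> b" by (rule other_end)
    then show thesis using that[of e w 0] 1 e arc_0 by simp
  next
    case 2
    then obtain a b where ab: "ends H e = {a, b}" using loopless[of e] by (auto simp: card_2_iff)
    show thesis
    proof (cases "p e 0 = \<phi> a")
      case True
      then show thesis using that[of e a i] ab 2 by (auto simp: arc_def len_def)
    next
      case False
      then show thesis using that[of e a "len e - i"] ab 2 by (auto simp: arc_def len_def)
    qed
  qed
qed

lemma arc_in_verts:
  assumes "e \<in> edges H" "i \<le> len e"
  shows "arc a e i \<in> verts G"
proof -
  have "p e j \<in> verts G" if "j \<le> n e + 1" for j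
  proof (cases "j \<in> {1..n e}")
    case True
    then show ?thesis using assms verts_G by fastforce
  next
    case False
    then have "j = 0 \<or> j = n e + 1" using that by auto
    then have "p e j \<in> \<phi> ` ends H e" using p_ends[OF assms(1)] by auto
    then show ?thesis using ends_H[OF assms(1)] verts_G by auto
  qed
  then show ?thesis using assms(2) by (simp add: arc_def len_def)
qed

section \<open>Chip moves along subdivided edges and across cuts of the original graph\<close>

lemma fire_interior:
  assumes e: "e \<in> edges H" and i: "i \<in> {1..n e}"
  shows "chip_equiv G {#p e i, p e i#} {#p e (i - 1), p e (i + 1)#}"
proof -
  \<comment> \<open>The cut around one bivalent vertex consists of \<open>q e (i - 1)\<close> and
    \<open>q e i\<close>. Both carry a chip away from \<open>p e i\<close>, the former down to
    \<open>p e (i - 1)\<close> and the latter up to \<open>p e (i + 1)\<close>.\<close>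
  let ?s = "\<lambda>_. p e i" and ?t = "\<lambda>j. if j = i then p e (i + 1) else p e (i - 1)"
  have "chip_equiv G (image_mset ?s (mset_set {i - 1, i})) (image_mset ?t (mset_set {i - 1, i}))"
  proof (rule fire_cut[where W = "{p e i}" and c = "q e"])
    show "{p e i} \<subseteq> verts G" using e i verts_G by auto
    show "inj_on (q e) {i - 1, i}" using q_inj(2)[OF e _ e] i by (auto simp: inj_on_def)
    have neq: "p e (i - 1) \<noteq> p e i" "p e (i + 1) \<noteq> p e i"
    proof -
      have "i - 1 \<le> n e + 1" "i + 1 \<le> n e + 1" "i - 1 \<noteq> i" "i + 1 \<noteq> i" using i by auto
      then show "p e (i - 1) \<noteq> p e i" "p e (i + 1) \<noteq> p e i"
        using p_eq_interior[OF e _ e i] by blast+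
    qed
    show ends: "ends G (q e j) = {?s j, ?t j} \<and> ?s j \<in> {p e i} \<and> ?t j \<notin> {p e i}"
      if "j \<in> {i - 1, i}" for j
      using that i neq q_ends[OF e, of j] by auto
    have "q e ` {i - 1, i} \<subseteq> {x \<in> edges G. ends G x \<inter> {p e i} \<noteq> {} \<and> \<not> ends G x \<subseteq> {p e i}}"
    proof
      fix x assume "x \<in> q e ` {i - 1, i}"
      then obtain j where j: "j \<in> {i - 1, i}" "x = q e j" by blast
      then have "j \<in> {0..n e}" using i by auto
      then have "x \<in> edges G" using j(2) e by (force simp: edges_G)
      then show "x \<in> {x \<in> edges G. ends G x \<inter> {p e i} \<noteq> {} \<and> \<not> ends G x \<subseteq> {p e i}}"
        using ends[OF j(1)] j(2) by blast
    qed
    moreover have "x \<in> q e ` {i - 1, i}" if x: "x \<in> edges G" and "ends G x \<inter> {p e i} \<noteq> {}" for x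
    proof -
      obtain e' j where j: "e' \<in> edges H" "j \<le> n e'" "x = q e' j" using x edges_G by auto
      then have "p e' j = p e i \<or> p e' (j + 1) = p e i"
        using that(2) q_ends[of e' j] by auto
      then have "e' = e \<and> (j = i \<or> j + 1 = i)"
        using p_eq_interior[OF j(1) _ e i, of j] p_eq_interior[OF j(1) _ e i, of "j + 1"] j(2) by auto
      then show ?thesis using j by auto
    qed
    ultimately show "{x \<in> edges G. ends G x \<inter> {p e i} \<noteq> {} \<and> \<not> ends G x \<subseteq> {p e i}} = q e ` {i - 1, i}"
      by blast
  qed simp
  moreover have "i - 1 \<noteq> i" using i by auto
  ultimately show ?thesis by (simp add: add_mset_commute)
qed

lemma affine_arc:
  assumes "e \<in> edges H"
  shows "affine_chain G (arc a e) (len e)"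
proof (rule affine_chainI)
  fix i assume "0 < i" "i < len e"
  then obtain j where j: "j \<in> {1..n e}" "arc a e i = p e j"
    "{arc a e (i - 1), arc a e (i + 1)} = {p e (j - 1), p e (j + 1)}"
    by (rule arc_interior)
  then have "{#arc a e (i - 1), arc a e (i + 1)#} = {#p e (j - 1), p e (j + 1)#}"
    by (auto simp: doubleton_eq_iff add_mset_commute)
  then show "chip_equiv G {#arc a e i, arc a e i#} {#arc a e (i - 1), arc a e (i + 1)#}"
    using fire_interior[OF assms j(1)] j(2) by simp
qed

text \<open>The fired set consists of the images of \<open>S\<close> and the interior vertices of
  all edges with both ends in \<open>S\<close>. Its cut in \<open>G\<close> is formed by the first
  edges of the arcs that leave \<open>S\<close>, so each chip advances from index 0 to index
  1.\<close>

lemma fire_cut_H: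
  assumes S: "S \<subseteq> verts H"
    and C: "C = {e \<in> edges H. ends H e \<inter> S \<noteq> {} \<and> \<not> ends H e \<subseteq> S}"
    and src: "\<And>e. e \<in> C \<Longrightarrow> src e \<in> ends H e \<inter> S"
  shows "chip_equiv G (image_mset (\<lambda>e. arc (src e) e 0) (mset_set C))
    (image_mset (\<lambda>e. arc (src e) e 1) (mset_set C))"
proof (rule fire_cut[where c = "\<lambda>e. arc_edge (src e) e 0"])
  define W where "W = \<phi> ` S \<union> (\<lambda>(e, i). p e i) ` (SIGMA e:{e \<in> edges H. ends H e \<subseteq> S}. {1..n e})"
  show "W \<subseteq> verts G" using S by (auto simp: W_def verts_G)
  have \<phi>_W: "\<phi> w \<in> W \<longleftrightarrow> w \<in> S" if "w \<in> verts H" for w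
  proof -
    have "\<phi> w \<in> \<phi> ` S \<longleftrightarrow> w \<in> S" using inj_on_image_mem_iff[OF inj_\<phi> that S] .
    moreover have "\<phi> w \<notin> (\<lambda>(e, i). p e i) ` (SIGMA e:{e \<in> edges H. ends H e \<subseteq> S}. {1..n e})"
      using interior_not_\<phi>[OF _ _ that] by force
    ultimately show ?thesis by (simp add: W_def)
  qed
  have p_W: "p e i \<in> W \<longleftrightarrow> ends H e \<subseteq> S" if "e \<in> edges H" "i \<in> {1..n e}" for e i
  proof -
    have "p e i \<notin> \<phi> ` S" using interior_not_\<phi>[OF that] S by blast
    show ?thesis
    proof
      assume "p e i \<in> W"
      then obtain e' i' where *: "e' \<in> edges H" "ends H e' \<subseteq> S" "i' \<in> {1..n e'}" "p e i = p e' i'"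
        using \<open>p e i \<notin> \<phi> ` S\<close> by (auto simp: W_def)
      then show "ends H e \<subseteq> S" using interior_inj(1)[OF that *(1,3,4)] by simp
    next
      assume "ends H e \<subseteq> S"
      then show "p e i \<in> W" using that by (force simp: W_def)
    qed
  qed
  have arc_W: "arc a e i \<in> W \<longleftrightarrow> (if i = 0 then a \<in> S else if i = len e then b \<in> S else ends H e \<subseteq> S)"
    if "e \<in> edges H" "ends H e = {a, b}" "a \<noteq> b" "i \<le> len e" for e a b i
  proof -
    have "a \<in> verts H" "b \<in> verts H" using ends_H that by auto
    moreover have "arc a e i \<in> W \<longleftrightarrow> ends H e \<subseteq> S" if "0 < i" "i < len e"
      using arc_interior[OF that, of a] p_W[OF \<open>e \<in> edges H\<close>] by metis
    ultimately show ?thesis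
      using that arc_0[of e a b] arc_len[of e a b] \<phi>_W[of a] \<phi>_W[of b] by auto
  qed
  show "finite C" using finite_edges_H C by simp
  have CH: "e \<in> edges H" if "e \<in> C" for e using that C by simp
  show "inj_on (\<lambda>e. arc_edge (src e) e 0) C"
    using arc_edge_inj CH by (force simp: inj_on_def len_def)
  show ends: "ends G (arc_edge (src e) e 0) = {arc (src e) e 0, arc (src e) e 1}
      \<and> arc (src e) e 0 \<in> W \<and> arc (src e) e 1 \<notin> W" if "e \<in> C" for e
  proof -
    have e: "e \<in> edges H" "src e \<in> ends H e" "src e \<in> S" "\<not> ends H e \<subseteq> S"
      using that C src by auto
    then obtain b where b: "ends H e = {src e, b}" "src e \<noteq> b" using other_end by metis
    then show ?thesis
      using arc_W[OF e(1) b, of 0] arc_W[OF e(1) b, of 1] ends_arc_edge[OF e(1), of 0 "src e"] e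
      by (auto simp: len_def)
  qed
  have "x \<in> (\<lambda>e. arc_edge (src e) e 0) ` C"
    if x: "x \<in> edges G" "ends G x \<inter> W \<noteq> {}" "\<not> ends G x \<subseteq> W" for x
  proof -
    obtain e j0 where e: "e \<in> edges H" "j0 \<le> n e" "x = q e j0" using x(1) edges_G by auto
    \<comment> \<open>The arc containing \<open>x\<close> is read from \<open>src e\<close> if
      \<open>e\<close> is a cut edge, and from any end otherwise. Membership in \<open>W\<close>
      then drops right after index 0 on cut arcs and is constant on all other arcs.\<close>
    obtain a where a: "a \<in> ends H e" "e \<in> C \<Longrightarrow> a = src e"
      using loopless[OF e(1)] src[of e] by (cases "e \<in> C") (auto simp: card_2_iff)
    obtain j where j: "j < len e" "x = arc_edge a e j" using q_eq_arc_edge[OF e(2)] e(3) by metis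
    obtain b where b: "ends H e = {a, b}" "a \<noteq> b" using other_end[OF e(1) a(1)] by metis
    have ends_x: "ends G x = {arc a e j, arc a e (j + 1)}" using ends_arc_edge[OF e(1) j(1)] j(2) by simp
    have *: "(arc a e j \<in> W) \<noteq> (arc a e (j + 1) \<in> W)" using x ends_x by auto
    have j_W: "arc a e j \<in> W \<longleftrightarrow> (if j = 0 then a \<in> S else ends H e \<subseteq> S)"
      using arc_W[OF e(1) b, of j] j(1) by simp
    have Suc_j_W: "arc a e (j + 1) \<in> W \<longleftrightarrow> (if j + 1 = len e then b \<in> S else ends H e \<subseteq> S)"
      using arc_W[OF e(1) b, of "j + 1"] j(1) by simp
    have "e \<in> C"
    proof (rule ccontr)
      assume "e \<notin> C"
      then have "ends H e \<inter> S = {} \<or> ends H e \<subseteq> S" using e(1) by (auto simp: C)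
      then have "a \<in> S \<longleftrightarrow> ends H e \<subseteq> S" "b \<in> S \<longleftrightarrow> ends H e \<subseteq> S" using b by auto
      with * j_W Suc_j_W show False by metis
    qed
    then have "\<not> ends H e \<subseteq> S" "a \<in> S" using a(2) src by (auto simp: C)
    then have "b \<notin> S" using b by auto
    with * j_W Suc_j_W \<open>\<not> ends H e \<subseteq> S\<close> have "j = 0" by metis
    with \<open>e \<in> C\<close> show ?thesis using j a(2) by auto
  qed
  moreover have "(\<lambda>e. arc_edge (src e) e 0) ` C \<subseteq> {x \<in> edges G. ends G x \<inter> W \<noteq> {} \<and> \<not> ends G x \<subseteq> W}"
    using ends ends_arc_edge(1)[OF CH] by (auto simp: len_def)
  ultimately show "{x \<in> edges G. ends G x \<inter> W \<noteq> {} \<and> \<not> ends G x \<subseteq> W} = (\<lambda>e. arc_edge (src e) e 0) ` C"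
    by blast
qed

text \<open>Firing the cut only moves chips from index 0 to index 1. To advance chips from arbitrary
  positions, auxiliary chips are put on index 1: affinity trades positions \<open>j e + t\<close>
  and 1 for \<open>j e + Suc t\<close> and 0, firing the cut brings the chips on 0 back to 1, and
  the auxiliary chips cancel.\<close>

lemma cut_shift:
  assumes S: "S \<subseteq> verts H"
    and C: "C = {e \<in> edges H. ends H e \<inter> S \<noteq> {} \<and> \<not> ends H e \<subseteq> S}"
    and src: "\<And>e. e \<in> C \<Longrightarrow> src e \<in> ends H e \<inter> S"
    and "\<And>e. e \<in> C \<Longrightarrow> j e + t \<le> len e"
  shows "chip_equiv G (image_mset (\<lambda>e. arc (src e) e (j e)) (mset_set C))
    (image_mset (\<lambda>e. arc (src e) e (j e + t)) (mset_set C))"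
  using assms(4)
proof (induction t)
  case (Suc t)
  let ?A = "\<lambda>k. image_mset (\<lambda>e. arc (src e) e (k e)) (mset_set C)"
  have "chip_equiv G (?A (\<lambda>e. j e + t) + ?A (\<lambda>e. 1)) (?A (\<lambda>e. j e + Suc t) + ?A (\<lambda>e. 0))"
  proof (rule chip_equiv_image_mset)
    show "finite C" using finite_edges_H C by simp
    show "chip_equiv G {#arc (src e) e (j e + t), arc (src e) e 1#}
        {#arc (src e) e (j e + Suc t), arc (src e) e 0#}" if "e \<in> C" for e
      using Suc.prems[OF that] that C by (intro affine_chainD[OF affine_arc]) (auto simp: len_def)
  qed
  also have "chip_equiv G \<dots> (?A (\<lambda>e. j e + Suc t) + ?A (\<lambda>e. 1))"
    by (intro chip_equiv_add chip_equiv_refl fire_cut_H[OF S C src])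
  finally have "chip_equiv G (?A (\<lambda>e. j e + t)) (?A (\<lambda>e. j e + Suc t))" by simp
  moreover have "chip_equiv G (?A j) (?A (\<lambda>e. j e + t))"
  proof (rule Suc.IH)
    show "j e + t \<le> len e" if "e \<in> C" for e using Suc.prems[OF that] by simp
  qed
  ultimately show ?case using chip_equiv_trans by blast
qed simp

lemma cut_shift2:
  assumes "S \<subseteq> verts H"
    and "{e \<in> edges H. ends H e \<inter> S \<noteq> {} \<and> \<not> ends H e \<subseteq> S} = {e1, e2}"
    and "e1 \<noteq> e2"
    and "a1 \<in> ends H e1 \<inter> S" "a2 \<in> ends H e2 \<inter> S"
    and "j1 + t \<le> len e1" "j2 + t \<le> len e2"
  shows "chip_equiv G {#arc a1 e1 j1, arc a2 e2 j2#} {#arc a1 e1 (j1 + t), arc a2 e2 (j2 + t)#}"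
proof -
  let ?a = "\<lambda>e. if e = e1 then a1 else a2" and ?j = "\<lambda>e. if e = e1 then j1 else j2"
  have "chip_equiv G (image_mset (\<lambda>e. arc (?a e) e (?j e)) (mset_set {e1, e2}))
      (image_mset (\<lambda>e. arc (?a e) e (?j e + t)) (mset_set {e1, e2}))"
    by (rule cut_shift[OF assms(1) assms(2)[symmetric]]) (use assms(3-) in auto)
  then show ?thesis using assms(3) by simp
qed

lemma cut_shift3:
  assumes "S \<subseteq> verts H"
    and "{e \<in> edges H. ends H e \<inter> S \<noteq> {} \<and> \<not> ends H e \<subseteq> S} = {e1, e2, e3}"
    and "e1 \<noteq> e2" "e1 \<noteq> e3" "e2 \<noteq> e3"
    and "a1 \<in> ends H e1 \<inter> S" "a2 \<in> ends H e2 \<inter> S" "a3 \<in> ends H e3 \<inter> S"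
    and "j1 + t \<le> len e1" "j2 + t \<le> len e2" "j3 + t \<le> len e3"
  shows "chip_equiv G {#arc a1 e1 j1, arc a2 e2 j2, arc a3 e3 j3#}
    {#arc a1 e1 (j1 + t), arc a2 e2 (j2 + t), arc a3 e3 (j3 + t)#}"
proof -
  let ?a = "\<lambda>e. if e = e1 then a1 else if e = e2 then a2 else a3"
    and ?j = "\<lambda>e. if e = e1 then j1 else if e = e2 then j2 else j3"
  have "chip_equiv G (image_mset (\<lambda>e. arc (?a e) e (?j e)) (mset_set {e1, e2, e3}))
      (image_mset (\<lambda>e. arc (?a e) e (?j e + t)) (mset_set {e1, e2, e3}))"
    by (rule cut_shift[OF assms(1) assms(2)[symmetric]]) (use assms(3-) in auto)
  then show ?thesis using assms(3-5) by simp
qed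

end

section \<open>Crossing cells with one spare chip\<close>

text \<open>The spare chip \<open>s\<close> is used up: the chip \<open>t\<close> stays behind in the cells that were crossed.\<close>

definition crosses :: "('v, 'e) mgraph \<Rightarrow> 'v \<Rightarrow> 'v \<Rightarrow> 'v \<Rightarrow> 'v \<Rightarrow> 'v set \<Rightarrow> bool" where
  "crosses G x y x' y' V \<longleftrightarrow> (\<exists>s\<in>V. \<exists>t. chip_equiv G {#x, y, s#} {#x', y', t#} \<and>
    (\<forall>v\<in>V. covers G {#x, y, s#} v))"

lemma crosses_commute: "crosses G x y x' y' V \<longleftrightarrow> crosses G y x y' x' V"
  by (simp add: crosses_def add_mset_commute)

text \<open>While one of the two chips moves to \<open>i\<close>, the other moves to
  \<open>a + b - i\<close>, which stays between \<open>a\<close> and \<open>b\<close>.\<close>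

lemma covers_affine:
  assumes "affine_chain G c L" "a \<le> i" "i \<le> b" "b \<le> L" "M = {#c a, c b#} + K"
  shows "covers G M (c i)"
proof -
  have "chip_equiv G {#c a, c b#} {#c i, c (a + b - i)#}"
    using assms by (intro affine_chainD[OF assms(1)]) auto
  then have "covers G {#c a, c b#} (c i)" by (rule coversI) simp
  then show ?thesis using assms(5) covers_add by metis
qed

text \<open>Three chips run at equal speed towards the common centre \<open>z\<close>, and
  \<open>\<tau>\<close> is the time at which the first of them arrives. If \<open>c1 i\<close> has
  not been passed by then, a chip of another arm is at \<open>z\<close>, which is also the end of
  the first arm, and the two chips on that arm cover what remains.\<close>

lemma star_covers_arm:
  assumes aff: "affine_chain G c1 L1"
    and center: "c1 L1 = z" "c2 L2 = z" "c3 L3 = z"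
    and j: "j1 \<le> L1" "j2 \<le> L2" "j3 \<le> L3"
    and star: "\<And>t. j1 + t \<le> L1 \<Longrightarrow> j2 + t \<le> L2 \<Longrightarrow> j3 + t \<le> L3 \<Longrightarrow>
      chip_equiv G {#c1 j1, c2 j2, c3 j3#} {#c1 (j1 + t), c2 (j2 + t), c3 (j3 + t)#}"
    and i: "j1 \<le> i" "i \<le> L1"
  shows "covers G {#c1 j1, c2 j2, c3 j3#} (c1 i)"
proof -
  define \<tau> where "\<tau> = min (L1 - j1) (min (L2 - j2) (L3 - j3))"
  show ?thesis
  proof (cases "i \<le> j1 + \<tau>")
    case True
    then show ?thesis
      using i j by (intro coversI[OF star[of "i - j1"]]) (auto simp: \<tau>_def)
  next
    case False
    have "chip_equiv G {#c1 j1, c2 j2, c3 j3#} {#c1 (j1 + \<tau>), c2 (j2 + \<tau>), c3 (j3 + \<tau>)#}"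
      using j by (intro star) (auto simp: \<tau>_def)
    moreover have "j2 + \<tau> = L2 \<or> j3 + \<tau> = L3"
      using False i j by (auto simp: \<tau>_def min_def split: if_splits)
    then have "\<exists>K. {#c1 (j1 + \<tau>), c2 (j2 + \<tau>), c3 (j3 + \<tau>)#} = {#c1 (j1 + \<tau>), c1 L1#} + K"
      using center by auto
    then have "covers G {#c1 (j1 + \<tau>), c2 (j2 + \<tau>), c3 (j3 + \<tau>)#} (c1 i)"
      using covers_affine[OF aff] False i by (metis linear order_refl)
    ultimately show ?thesis by (rule covers_cong)
  qed
qed

text \<open>The spare chip waits on the longer chain \<open>b\<close> at distance \<open>m\<close>
  from its end, so it finishes together with the chip on \<open>a\<close>. The chip on
  \<open>b 0\<close> stays behind, and the final chips on both ends of \<open>b\<close> cover all of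
  \<open>b\<close>.\<close>

lemma crosses_one_cell:
  assumes "m \<le> l" and aff: "affine_chain G b l"
    and cut: "\<And>i j t. i + t \<le> m \<Longrightarrow> j + t \<le> l \<Longrightarrow> chip_equiv G {#a i, b j#} {#a (i + t), b (j + t)#}"
  shows "crosses G (a 0) (b 0) (a m) (b l) (a ` {..m} \<union> b ` {..l})"
proof -
  let ?M = "{#a 0, b 0, b (l - m)#}"
  have move: "chip_equiv G ?M {#a i, b (l - m + i), b 0#}" if "i \<le> m" for i
    using chip_equiv_spare[OF cut[of 0 i "l - m"], of "b 0"] that assms(1)
    by (simp add: add_mset_commute)
  have final: "chip_equiv G ?M {#a m, b l, b 0#}" using move[of m] assms(1) by simp
  have "covers G ?M (a i)" if "i \<le> m" for i
    using move[OF that] by (rule coversI) simp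
  moreover have "covers G ?M (b i)" if "i \<le> l" for i
    by (rule covers_cong[OF final], rule covers_affine[OF aff, of 0 _ l _ "{#a m#}"])
      (use that in \<open>auto simp: add_mset_commute\<close>)
  ultimately show ?thesis
    unfolding crosses_def using final
    by (intro bexI[of _ "b (l - m)"] exI[of _ "b 0"]) auto
qed

text \<open>Two adjacent cells: \<open>a\<close> is continued by \<open>a'\<close> and
  \<open>b\<close> by \<open>b'\<close>, while \<open>r\<close> is the rung between the cells, from
  the \<open>a\<close> side to the \<open>b\<close> side. \<open>cut1\<close> and
  \<open>cut2\<close> advance a pair of chips in the first and in the second cell.\<close>

context
  fixes G :: "('v, 'e) mgraph" and a a' b b' r :: "nat \<Rightarrow> 'v" and m m' l l' R :: nat
  assumes corners: "a m = r 0" "a' 0 = r 0" "b l = r R" "b' 0 = r R"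
    and affine: "affine_chain G a' m'" "affine_chain G b l" "affine_chain G b' l'"
      "affine_chain G r R"
    and cut1: "\<And>i j t. i + t \<le> m \<Longrightarrow> j + t \<le> l \<Longrightarrow>
      chip_equiv G {#a i, b j#} {#a (i + t), b (j + t)#}"
    and cut2: "\<And>i j t. i + t \<le> m' \<Longrightarrow> j + t \<le> l' \<Longrightarrow>
      chip_equiv G {#a' i, b' j#} {#a' (i + t), b' (j + t)#}"
begin

text \<open>
  Both cells are shorter on the \<open>a\<close> side. The middle position has one chip on the central \<open>a\<close>
  vertex and one inside each \<open>b\<close> edge; from there the three chips run towards the central \<open>b\<close>
  vertex.
\<close>

lemma crosses_two_cells_same_side:
  assumes short: "m \<le> l" "m' \<le> l'"
    and star: "\<And>i j k t. i + t \<le> l \<Longrightarrow> t \<le> j \<Longrightarrow> j \<le> l' \<Longrightarrow> k + t \<le> R \<Longrightarrow>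
      chip_equiv G {#b i, b' j, r k#} {#b (i + t), b' (j - t), r (k + t)#}"
  shows "crosses G (a 0) (b 0) (a' m') (b' l')
    (a ` {..m} \<union> b ` {..l} \<union> a' ` {..m'} \<union> b' ` {..l'} \<union> r ` {..R})"
proof -
  \<comment> \<open>The spare chip is at distance \<open>m'\<close>, the length of
    \<open>a'\<close>, from the end of \<open>b'\<close>, so both chips finish the second cell
    together.\<close>
  define s where "s = b' (l' - m')"
  let ?M = "{#a 0, b 0, s#}" and ?mid = "{#b m, s, r 0#}"
  have move1: "chip_equiv G ?M {#a i, b i, s#}" if "i \<le> m" for i
    using cut1[of 0 i 0] that short by (intro chip_equiv_spare) simp
  have mid: "chip_equiv G ?M ?mid"
    using move1[of m] corners by (simp add: add_mset_commute)
  have move2: "chip_equiv G ?M {#a' i, b' (l' - m' + i), b m#}" if "i \<le> m'" for i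
  proof -
    have "chip_equiv G ?mid {#a' i, b' (l' - m' + i), b m#}"
      using chip_equiv_spare[OF cut2[of 0 i "l' - m'"], of "b m"] that short corners
      by (simp add: add_mset_commute s_def)
    with mid show ?thesis by (rule chip_equiv_trans)
  qed
  \<comment> \<open>Read backwards, \<open>b'\<close> ends in the central vertex \<open>r R\<close>
    and becomes an arm of the star.\<close>
  define rb where "rb = (\<lambda>i. b' (l' - i))"
  have rb_end: "rb l' = r R" using corners by (simp add: rb_def)
  have aff': "affine_chain G rb l'"
    unfolding affine_chain_def rb_def using affine_chainD[OF affine(3)] by simp
  have star': "chip_equiv G {#b m, rb m', r 0#} {#b (m + t), rb (m' + t), r t#}"
    if "m + t \<le> l" "m' + t \<le> l'" "t \<le> R" for t
    using star[of m t "l' - m'" 0] that by (simp add: rb_def)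
  have mid_eq: "?mid = {#b m, rb m', r 0#}" by (simp add: s_def rb_def)
  have "covers G ?M (a i)" if "i \<le> m" for i
    using move1[OF that] by (rule coversI) simp
  moreover have "covers G ?M (a' i)" if "i \<le> m'" for i
    using move2[OF that] by (rule coversI) simp
  moreover have "covers G ?M (b i)" if "i \<le> l" for i
  proof (cases "i \<le> m")
    case True
    show ?thesis using move1[OF True] by (rule coversI) simp
  next
    case False
    have "covers G ?mid (b i)"
      unfolding mid_eq
      by (rule star_covers_arm[OF affine(2), of "r R" _ l' _ R])
        (use False that star' corners rb_end short in auto)
    with mid show ?thesis by (rule covers_cong)
  qed
  moreover have "covers G ?M (b' i)" if "i \<le> l'" for i
  proof (cases "l' - m' \<le> i")
    case True
    then show ?thesis
      using that by (intro coversI[OF move2[of "i - (l' - m')"]]) auto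
  next
    case False
    have "covers G {#rb m', b m, r 0#} (rb (l' - i))"
      by (rule star_covers_arm[OF aff', of "r R" _ l _ R])
        (use False that star' corners rb_end short in \<open>auto simp: add_mset_commute\<close>)
    moreover have "{#rb m', b m, r 0#} = ?mid"
      by (simp add: rb_def s_def add_mset_commute)
    moreover have "rb (l' - i) = b' i" using that by (simp add: rb_def)
    ultimately have "covers G ?mid (b' i)" by simp
    with mid show ?thesis by (rule covers_cong)
  qed
  moreover have "covers G ?M (r i)" if "i \<le> R" for i
  proof -
    have "covers G {#r 0, b m, rb m'#} (r i)"
      by (rule star_covers_arm[OF affine(4), of "r R" _ l _ l'])
        (use that star' corners rb_end short in \<open>auto simp: add_mset_commute\<close>)
    moreover have "{#r 0, b m, rb m'#} = ?mid"
      by (simp add: rb_def s_def add_mset_commute)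
    ultimately have "covers G ?mid (r i)" by simp
    with mid show ?thesis by (rule covers_cong)
  qed
  moreover have "chip_equiv G ?M {#a' m', b' l', b m#}"
    using move2[of m'] short by simp
  ultimately show ?thesis
    unfolding crosses_def by (intro bexI[of _ s] exI[of _ "b m"]) (auto simp: s_def)
qed

text \<open>
  The first cell is shorter on the \<open>a\<close> side, the second one on the \<open>b\<close> side. Three chips cross the
  middle column along \<open>b\<close>, \<open>r\<close> and \<open>a'\<close> for as long as all of them can; \<open>\<rho>\<close> is chosen such that
  the first position has a chip on the central \<open>a\<close> vertex and the last one has a chip on the central
  \<open>b\<close> vertex.
\<close>

lemma crosses_two_cells_opposite_sides:
  assumes short: "m \<le> l" "l' \<le> m'"
    and cut3: "\<And>i j k t. i + t \<le> l \<Longrightarrow> j + t \<le> m' \<Longrightarrow> k + t \<le> R \<Longrightarrow>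
      chip_equiv G {#b i, a' j, r k#} {#b (i + t), a' (j + t), r (k + t)#}"
  shows "crosses G (a 0) (b 0) (a' m') (b' l')
    (a ` {..m} \<union> b ` {..l} \<union> a' ` {..m'} \<union> b' ` {..l'} \<union> r ` {..R})"
proof -
  \<comment> \<open>From index \<open>\<alpha>\<close> on, the second cell is finished in
    \<open>l'\<close> steps on \<open>a'\<close>; \<open>\<beta>\<close> is what remains of
    \<open>b\<close> when the chip on \<open>a\<close> arrives.\<close>
  define \<alpha> \<beta> where "\<alpha> = m' - l'" and "\<beta> = l - m"
  define \<tau> where "\<tau> = min \<alpha> (min \<beta> R)"
  \<comment> \<open>If \<open>\<tau> = \<alpha>\<close>, the chip on \<open>a'\<close> starts at the
    central \<open>a\<close> vertex and the chip on \<open>r\<close> is placed so as to end at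
    \<open>r R\<close>. Otherwise the chip on \<open>r\<close> starts at the central
    \<open>a\<close> vertex, and the minimum is attained at \<open>\<beta>\<close> or
    \<open>R\<close>, so the chip on \<open>b\<close> or the one on \<open>r\<close> ends at the
    central \<open>b\<close> vertex.\<close>
  define \<rho> where "\<rho> = (if \<tau> = \<alpha> then R - \<tau> else 0)"
  \<comment> \<open>Of the chips on \<open>a'\<close> and \<open>r\<close> in the first position,
    one is delivered by \<open>a\<close> to the central vertex; the other one is the spare chip.
    Dually, \<open>t\<close> is the chip on \<open>b\<close> or \<open>r\<close> that does not
    continue along \<open>b'\<close>.\<close>
  define s where "s = (if \<tau> = \<alpha> then r \<rho> else a' (\<alpha> - \<tau>))"
  define t where "t = (if \<rho> + \<tau> = R then b (m + \<tau>) else r (\<rho> + \<tau>))"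
  let ?M = "{#a 0, b 0, s#}"
  let ?A = "{#b m, a' (\<alpha> - \<tau>), r \<rho>#}" and ?B = "{#b (m + \<tau>), a' \<alpha>, r (\<rho> + \<tau>)#}"
  have le: "\<tau> \<le> \<alpha>" "\<tau> \<le> \<beta>" "\<rho> + \<tau> \<le> R" "\<alpha> + l' = m'" "m + \<beta> = l"
    using short by (auto simp: \<tau>_def \<rho>_def \<alpha>_def \<beta>_def)
  have start: "\<tau> = \<alpha> \<or> \<rho> = 0" and stop: "\<tau> = \<beta> \<or> \<rho> + \<tau> = R"
    by (auto simp: \<tau>_def \<rho>_def min_def split: if_splits)
  have A_eq: "?A = {#a m, b m, s#}"
    using start corners by (auto simp: s_def add_mset_commute)
  have B_eq: "?B = {#a' \<alpha>, b' 0, t#}"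
    using stop corners le by (auto simp: t_def add_mset_commute)
  have move1: "chip_equiv G ?M {#a i, b i, s#}" if "i \<le> m" for i
    using cut1[of 0 i 0] that short by (intro chip_equiv_spare) simp
  have A: "chip_equiv G ?M ?A" unfolding A_eq by (rule move1) simp
  have move2: "chip_equiv G ?M {#b (m + i), a' (\<alpha> - \<tau> + i), r (\<rho> + i)#}" if "i \<le> \<tau>" for i
    by (rule chip_equiv_trans[OF A cut3]) (use le that in auto)
  have B: "chip_equiv G ?M ?B" using move2[of \<tau>] le by simp
  have move3: "chip_equiv G ?M {#a' (\<alpha> + i), b' i, t#}" if "i \<le> l'" for i
  proof -
    have "chip_equiv G ?B {#a' (\<alpha> + i), b' i, t#}"
      unfolding B_eq using cut2[of \<alpha> i 0] that le by (intro chip_equiv_spare) simp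
    with B show ?thesis by (rule chip_equiv_trans)
  qed
  have "covers G ?M (a i)" if "i \<le> m" for i
    using move1[OF that] by (rule coversI) simp
  moreover have "covers G ?M (b' i)" if "i \<le> l'" for i
    using move3[OF that] by (rule coversI) simp
  \<comment> \<open>On \<open>b\<close>, \<open>a'\<close> and \<open>r\<close>, whatever is not
    swept by \<open>move1\<close>, \<open>move2\<close> or \<open>move3\<close> lies between two
    chips of \<open>?A\<close> or of \<open>?B\<close> on the same chain.\<close>
  moreover have "covers G ?M (b i)" if "i \<le> l" for i
  proof -
    consider "i \<le> m" | "m \<le> i" "i \<le> m + \<tau>" | "m + \<tau> < i" by linarith
    then show ?thesis
    proof cases
      case 1
      show ?thesis using move1[OF 1] by (rule coversI) simp
    next
      case 2
      then show ?thesis by (intro coversI[OF move2[of "i - m"]]) auto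
    next
      case 3
      then have "\<rho> + \<tau> = R" using stop le that by auto
      then have "covers G ?B (b i)"
        by (intro covers_affine[OF affine(2), of "m + \<tau>" _ l _ "{#a' \<alpha>#}"])
          (use 3 that corners in \<open>auto simp: add_mset_commute\<close>)
      with B show ?thesis by (rule covers_cong)
    qed
  qed
  moreover have "covers G ?M (a' i)" if "i \<le> m'" for i
  proof -
    consider "i < \<alpha> - \<tau>" | "\<alpha> - \<tau> \<le> i" "i \<le> \<alpha>" | "\<alpha> \<le> i" by linarith
    then show ?thesis
    proof cases
      case 1
      then have "\<rho> = 0" using start le by auto
      then have "covers G ?A (a' i)"
        by (intro covers_affine[OF affine(1), of 0 _ "\<alpha> - \<tau>" _ "{#b m#}"])
          (use 1 le corners in \<open>auto simp: add_mset_commute\<close>)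
      with A show ?thesis by (rule covers_cong)
    next
      case 2
      then have "chip_equiv G ?M {#b (m + (i - (\<alpha> - \<tau>))), a' i, r (\<rho> + (i - (\<alpha> - \<tau>)))#}"
        using move2[of "i - (\<alpha> - \<tau>)"] le by auto
      then show ?thesis by (rule coversI) simp
    next
      case 3
      then show ?thesis using that le by (intro coversI[OF move3[of "i - \<alpha>"]]) auto
    qed
  qed
  moreover have "covers G ?M (r i)" if "i \<le> R" for i
  proof -
    consider "i < \<rho>" | "\<rho> \<le> i" "i \<le> \<rho> + \<tau>" | "\<rho> + \<tau> < i" by linarith
    then show ?thesis
    proof cases
      case 1
      then have "\<tau> = \<alpha>" using start by auto
      then have "covers G ?A (r i)"
        by (intro covers_affine[OF affine(4), of 0 _ \<rho> _ "{#b m#}"])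
          (use 1 le corners in \<open>auto simp: add_mset_commute\<close>)
      with A show ?thesis by (rule covers_cong)
    next
      case 2
      then have "chip_equiv G ?M {#b (m + (i - \<rho>)), a' (\<alpha> - \<tau> + (i - \<rho>)), r i#}"
        using move2[of "i - \<rho>"] by auto
      then show ?thesis by (rule coversI) simp
    next
      case 3
      then have "m + \<tau> = l" using stop le that by auto
      then have "covers G ?B (r i)"
        by (intro covers_affine[OF affine(4), of "\<rho> + \<tau>" _ R _ "{#a' \<alpha>#}"])
          (use 3 that corners in \<open>auto simp: add_mset_commute\<close>)
      with B show ?thesis by (rule covers_cong)
    qed
  qed
  moreover have "chip_equiv G ?M {#a' m', b' l', t#}" using move3[of l'] le by simp
  moreover have "s \<in> r ` {..R} \<union> a' ` {..m'}" using le by (auto simp: s_def)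
  ultimately show ?thesis
    unfolding crosses_def by (intro bexI[of _ s] exI[of _ t]) auto
qed

end

section \<open>Subdivided ladders\<close>

text \<open>A boolean selects top or bottom, so that the side with the shorter rail can be named
  \<open>b\<close> and the crossing arguments apply without a separate mirrored version.\<close>

definition side :: "bool \<Rightarrow> nat \<Rightarrow> ladder_vertex" where
  "side b i = (if b then Top i else Bot i)"

definition rail :: "bool \<Rightarrow> nat \<Rightarrow> ladder_edge" where
  "rail b i = (if b then TopEdge i else BotEdge i)"

definition columns :: "nat \<Rightarrow> ladder_vertex set" where
  "columns i = Bot ` {1..i} \<union> Top ` {1..i}"

locale ladder_subdivision = subdivision G "ladder g" n \<phi> p q
  for G :: "('v, 'e) mgraph" and g n \<phi> p q +
  assumes g_ge_3: "g \<ge> 3"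
begin

lemma side_in_verts: "i \<in> {1..g - 1} \<Longrightarrow> side b i \<in> verts (ladder g)"
  by (auto simp: side_def ladder_def)

lemma ladder_vertsE:
  assumes "w \<in> verts (ladder g)"
  obtains b i where "i \<in> {1..g - 1}" "w = side b i"
proof -
  from assms consider i where "i \<in> {1..g - 1}" "w = Bot i" | i where "i \<in> {1..g - 1}" "w = Top i"
    by (auto simp: ladder_def)
  then show thesis
    by cases (use that[of _ False] that[of _ True] in \<open>auto simp: side_def\<close>)
qed

lemma rail_in_edges: "i \<in> {1..g - 2} \<Longrightarrow> rail b i \<in> edges (ladder g)"
  by (auto simp: rail_def ladder_def)

lemma ends_rail: "ends (ladder g) (rail b i) = {side b i, side b (i + 1)}"
  by (auto simp: rail_def side_def ladder_def)

lemma rung_in_edges: "i \<in> {2..g - 2} \<Longrightarrow> Rung i \<in> edges (ladder g)"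
  by (auto simp: ladder_def)

lemma ends_rung: "ends (ladder g) (Rung i) = {side b i, side (\<not> b) i}"
  by (auto simp: side_def ladder_def)

lemma side_eq_iff [simp]: "side b i = side c j \<longleftrightarrow> b = c \<and> i = j"
  by (auto simp: side_def)

lemma rail_eq_iff [simp]: "rail b i = rail c j \<longleftrightarrow> b = c \<and> i = j"
  "rail b i \<noteq> Rung j" "Rung j \<noteq> rail b i"
  by (auto simp: rail_def)

section \<open>Edge cuts of the ladder and the chip moves they allow\<close>

lemma cut_columns:
  assumes "i \<in> {1..g - 2}"
  shows "{e \<in> edges (ladder g). ends (ladder g) e \<inter> columns i \<noteq> {} \<and> \<not> ends (ladder g) e \<subseteq> columns i}
    = {rail b i, rail (\<not> b) i}"
proof (rule set_eqI)
  fix e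
  show "e \<in> {e \<in> edges (ladder g). ends (ladder g) e \<inter> columns i \<noteq> {} \<and> \<not> ends (ladder g) e \<subseteq> columns i}
      \<longleftrightarrow> e \<in> {rail b i, rail (\<not> b) i}"
    using assms by (cases e) (auto simp: ladder_def rail_def columns_def)
qed

text \<open>This oblique cut passes through one rail of each of two adjacent cells and the rung
  between them. It serves the case in which the two cells are shorter on opposite sides.\<close>

lemma cut_columns_side:
  assumes "1 \<le> i" "i + 2 \<le> g - 1" "S = insert (side b (i + 1)) (columns i)"
  shows "{e \<in> edges (ladder g). ends (ladder g) e \<inter> S \<noteq> {} \<and> \<not> ends (ladder g) e \<subseteq> S}
    = {rail (\<not> b) i, rail b (i + 1), Rung (i + 1)}"
proof (rule set_eqI)
  fix e
  show "e \<in> {e \<in> edges (ladder g). ends (ladder g) e \<inter> S \<noteq> {} \<and> \<not> ends (ladder g) e \<subseteq> S}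
      \<longleftrightarrow> e \<in> {rail (\<not> b) i, rail b (i + 1), Rung (i + 1)}"
    using assms by (cases e; cases b) (auto simp: ladder_def rail_def side_def columns_def)
qed

text \<open>Taking the complement of one vertex lets the three chips run towards that vertex, as in
  a star. It serves the case in which both cells are shorter on the same side.\<close>

lemma cut_vertex:
  assumes "1 \<le> i" "i + 2 \<le> g - 1" "S = verts (ladder g) - {side b (i + 1)}"
  shows "{e \<in> edges (ladder g). ends (ladder g) e \<inter> S \<noteq> {} \<and> \<not> ends (ladder g) e \<subseteq> S}
    = {rail b i, rail b (i + 1), Rung (i + 1)}"
proof (rule set_eqI)
  fix e
  show "e \<in> {e \<in> edges (ladder g). ends (ladder g) e \<inter> S \<noteq> {} \<and> \<not> ends (ladder g) e \<subseteq> S}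
      \<longleftrightarrow> e \<in> {rail b i, rail b (i + 1), Rung (i + 1)}"
    using assms by (cases e; cases b) (auto simp: ladder_def rail_def side_def)
qed

lemma shift_columns:
  assumes "i \<in> {1..g - 2}" "x + t \<le> len (rail b i)" "y + t \<le> len (rail (\<not> b) i)"
  shows "chip_equiv G {#arc (side b i) (rail b i) x, arc (side (\<not> b) i) (rail (\<not> b) i) y#}
    {#arc (side b i) (rail b i) (x + t), arc (side (\<not> b) i) (rail (\<not> b) i) (y + t)#}"
proof (rule cut_shift2[OF _ cut_columns[OF assms(1), of b]])
  show "columns i \<subseteq> verts (ladder g)" using assms(1) by (auto simp: columns_def ladder_def)
qed (use assms in \<open>auto simp: columns_def ends_rail side_def\<close>)

lemma shift_columns_side:
  assumes i: "1 \<le> i" "i + 2 \<le> g - 1"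
    and "x + t \<le> len (rail (\<not> b) i)" "y + t \<le> len (rail b (i + 1))" "z + t \<le> len (Rung (i + 1))"
  shows "chip_equiv G {#arc (side (\<not> b) i) (rail (\<not> b) i) x,
      arc (side b (i + 1)) (rail b (i + 1)) y, arc (side b (i + 1)) (Rung (i + 1)) z#}
    {#arc (side (\<not> b) i) (rail (\<not> b) i) (x + t),
      arc (side b (i + 1)) (rail b (i + 1)) (y + t), arc (side b (i + 1)) (Rung (i + 1)) (z + t)#}"
proof (rule cut_shift3[OF _ cut_columns_side[OF i refl, of b]])
  show "insert (side b (i + 1)) (columns i) \<subseteq> verts (ladder g)"
    using i side_in_verts[of "i + 1" b] by (auto simp: columns_def ladder_def)
  show "side b (i + 1) \<in> ends (ladder g) (Rung (i + 1)) \<inter> insert (side b (i + 1)) (columns i)"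
    using ends_rung[of "i + 1" b] by simp
qed (use assms in \<open>auto simp: columns_def ends_rail side_def\<close>)

text \<open>The rail \<open>i + 1\<close> starts at the vertex to which the chips run, so its arc is
  reversed before the cut is applied; its index therefore decreases to \<open>y - t\<close>.\<close>

lemma shift_vertex:
  assumes i: "1 \<le> i" "i + 2 \<le> g - 1"
    and "x + t \<le> len (rail b i)" "t \<le> y" "y \<le> len (rail b (i + 1))" "z + t \<le> len (Rung (i + 1))"
  shows "chip_equiv G {#arc (side b i) (rail b i) x,
      arc (side b (i + 1)) (rail b (i + 1)) y, arc (side (\<not> b) (i + 1)) (Rung (i + 1)) z#}
    {#arc (side b i) (rail b i) (x + t),
      arc (side b (i + 1)) (rail b (i + 1)) (y - t), arc (side (\<not> b) (i + 1)) (Rung (i + 1)) (z + t)#}"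
proof -
  let ?L = "len (rail b (i + 1))" and ?S = "verts (ladder g) - {side b (i + 1)}"
  have "chip_equiv G {#arc (side b i) (rail b i) x,
      arc (side b (i + 2)) (rail b (i + 1)) (?L - y), arc (side (\<not> b) (i + 1)) (Rung (i + 1)) z#}
    {#arc (side b i) (rail b i) (x + t),
      arc (side b (i + 2)) (rail b (i + 1)) (?L - y + t), arc (side (\<not> b) (i + 1)) (Rung (i + 1)) (z + t)#}"
  proof (rule cut_shift3[OF _ cut_vertex[OF i refl, of b]])
    show "side b i \<in> ends (ladder g) (rail b i) \<inter> ?S"
      "side b (i + 2) \<in> ends (ladder g) (rail b (i + 1)) \<inter> ?S"
      "side (\<not> b) (i + 1) \<in> ends (ladder g) (Rung (i + 1)) \<inter> ?S"
      using i side_in_verts[of i b] side_in_verts[of "i + 2" b] side_in_verts[of "i + 1" "\<not> b"]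
        ends_rung[of "i + 1" b]
      by (auto simp: ends_rail)
  qed (use assms in auto)
  moreover have rev: "arc (side b (i + 2)) (rail b (i + 1)) (?L - k) = arc (side b (i + 1)) (rail b (i + 1)) k"
    if "k \<le> ?L" for k
    using arc_rev[of "rail b (i + 1)" "side b (i + 1)" "side b (i + 2)" "?L - k"]
      rail_in_edges[of "i + 1" b] ends_rail[of b "i + 1"] that i by simp
  moreover have "arc (side b (i + 2)) (rail b (i + 1)) (?L - y + t) = arc (side b (i + 1)) (rail b (i + 1)) (y - t)"
    using rev[of "y - t"] assms(4,5) by simp
  ultimately show ?thesis using assms(5) by simp
qed

section \<open>Crossing the cells of a subdivided ladder\<close>

definition arc_set :: "ladder_edge \<Rightarrow> 'v set" where
  "arc_set e = {arc a e i | a i. a \<in> ends (ladder g) e \<and> i \<le> len e}"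

text \<open>By reversal, both starting points run through the same vertices, so any convenient end
  may be chosen.\<close>

lemma arc_set_eq:
  assumes "e \<in> edges (ladder g)" "a \<in> ends (ladder g) e"
  shows "arc_set e = arc a e ` {..len e}"
proof -
  obtain b where b: "ends (ladder g) e = {a, b}" "a \<noteq> b" using other_end[OF assms] by metis
  have "arc b e i \<in> arc a e ` {..len e}" if "i \<le> len e" for i
    using arc_rev[OF assms(1) b that] by auto
  then show ?thesis using b by (auto simp: arc_set_def)
qed

lemma arc_set_rail: "i \<in> {1..g - 2} \<Longrightarrow> arc_set (rail b i) = arc (side b i) (rail b i) ` {..len (rail b i)}"
  by (rule arc_set_eq) (auto simp: rail_in_edges ends_rail)

lemma arc_set_rung: "i \<in> {2..g - 2} \<Longrightarrow> arc_set (Rung i) = arc (side b i) (Rung i) ` {..len (Rung i)}"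
  by (rule arc_set_eq) (auto simp: rung_in_edges ends_rung[of _ b])

lemma arc_set_subset_verts: "e \<in> edges (ladder g) \<Longrightarrow> arc_set e \<subseteq> verts G"
  using arc_in_verts by (auto simp: arc_set_def)

lemma arc_rail:
  assumes "i \<in> {1..g - 2}"
  shows "arc (side b i) (rail b i) 0 = \<phi> (side b i)"
    and "arc (side b i) (rail b i) (len (rail b i)) = \<phi> (side b (i + 1))"
  using arc_0[of "rail b i" "side b i" "side b (i + 1)"] arc_len[of "rail b i" "side b i" "side b (i + 1)"]
    rail_in_edges[OF assms] by (auto simp: ends_rail)

lemma arc_rung:
  assumes "i \<in> {2..g - 2}"
  shows "arc (side b i) (Rung i) 0 = \<phi> (side b i)"
    and "arc (side b i) (Rung i) (len (Rung i)) = \<phi> (side (\<not> b) i)"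
  using arc_0[of "Rung i" "side b i" "side (\<not> b) i"] arc_len[of "Rung i" "side b i" "side (\<not> b) i"]
    rung_in_edges[OF assms] ends_rung by auto

lemma shorter_rail: "\<exists>b. len (rail b i) \<le> len (rail (\<not> b) i)"
proof (cases "len (rail True i) \<le> len (rail False i)")
  case True
  then show ?thesis by (intro exI[of _ True]) simp
next
  case False
  then show ?thesis by (intro exI[of _ False]) simp
qed

lemma crosses_cell:
  assumes i: "i \<in> {1..g - 2}"
  shows "crosses G (\<phi> (Bot i)) (\<phi> (Top i)) (\<phi> (Bot (i + 1))) (\<phi> (Top (i + 1)))
    (arc_set (rail False i) \<union> arc_set (rail True i))"
proof -
  obtain b where b: "len (rail b i) \<le> len (rail (\<not> b) i)" using shorter_rail by blast
  have "crosses G (\<phi> (side b i)) (\<phi> (side (\<not> b) i)) (\<phi> (side b (i + 1))) (\<phi> (side (\<not> b) (i + 1)))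
      (arc_set (rail b i) \<union> arc_set (rail (\<not> b) i))"
    using crosses_one_cell[where a = "arc (side b i) (rail b i)"
        and b = "arc (side (\<not> b) i) (rail (\<not> b) i)",
        OF b affine_arc[OF rail_in_edges[OF i]] shift_columns[OF i]]
    by (simp add: arc_rail[OF i] arc_set_rail[OF i])
  then show ?thesis
    by (cases b) (simp_all add: side_def crosses_commute Un_commute)
qed

text \<open>With \<open>b\<close> the shorter side of the first cell, the comparison in the second
  cell decides between the two crossings. In the first case the star is centred at the middle vertex
  of the side \<open>\<not> b\<close>; in the second the oblique cut around the side
  \<open>b\<close> is used.\<close>

lemma crosses_two_cells:
  assumes i: "1 \<le> i" "i + 2 \<le> g - 1"
  shows "crosses G (\<phi> (Bot i)) (\<phi> (Top i)) (\<phi> (Bot (i + 2))) (\<phi> (Top (i + 2)))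
    (arc_set (rail False i) \<union> arc_set (rail True i) \<union>
     arc_set (rail False (i + 1)) \<union> arc_set (rail True (i + 1)) \<union> arc_set (Rung (i + 1)))"
proof -
  have i': "i \<in> {1..g - 2}" "i + 1 \<in> {1..g - 2}" "i + 1 \<in> {2..g - 2}" using i by auto
  obtain b where b: "len (rail b i) \<le> len (rail (\<not> b) i)" using shorter_rail by blast
  let ?a = "arc (side b i) (rail b i)" and ?a' = "arc (side b (i + 1)) (rail b (i + 1))"
    and ?b = "arc (side (\<not> b) i) (rail (\<not> b) i)"
    and ?b' = "arc (side (\<not> b) (i + 1)) (rail (\<not> b) (i + 1))"
    and ?r = "arc (side b (i + 1)) (Rung (i + 1))"
  let ?m = "len (rail b i)" and ?m' = "len (rail b (i + 1))"
    and ?l = "len (rail (\<not> b) i)" and ?l' = "len (rail (\<not> b) (i + 1))" and ?R = "len (Rung (i + 1))"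
  have corners: "?a ?m = ?r 0" "?a' 0 = ?r 0" "?b ?l = ?r ?R" "?b' 0 = ?r ?R"
    using i' by (simp_all only: arc_rail arc_rung)
  have aff: "affine_chain G ?a' ?m'" "affine_chain G ?b ?l" "affine_chain G ?b' ?l'"
    "affine_chain G ?r ?R"
    using i' by (auto intro!: affine_arc rail_in_edges rung_in_edges)
  have "crosses G (?a 0) (?b 0) (?a' ?m') (?b' ?l')
    (?a ` {..?m} \<union> ?b ` {..?l} \<union> ?a' ` {..?m'} \<union> ?b' ` {..?l'} \<union> ?r ` {..?R})"
  proof (cases "?m' \<le> ?l'")
    case True
    show ?thesis
      by (rule crosses_two_cells_same_side[where a = ?a and a' = ?a' and b = ?b and b' = ?b' and
            r = ?r and m = ?m and m' = ?m' and l = ?l and l' = ?l' and R = ?R, OF corners aff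
            shift_columns[OF i'(1)] shift_columns[OF i'(2)] b True])
        (use shift_vertex[OF i, of _ _ "\<not> b"] in simp_all)
  next
    case False
    show ?thesis
      by (rule crosses_two_cells_opposite_sides[where a = ?a and a' = ?a' and b = ?b and b' = ?b' and
            r = ?r and m = ?m and m' = ?m' and l = ?l and l' = ?l' and R = ?R, OF corners aff
            shift_columns[OF i'(1)] shift_columns[OF i'(2)] b])
        (use False shift_columns_side[OF i] in simp_all)
  qed
  then have "crosses G (\<phi> (side b i)) (\<phi> (side (\<not> b) i)) (\<phi> (side b (i + 1 + 1)))
      (\<phi> (side (\<not> b) (i + 1 + 1)))
    (arc_set (rail b i) \<union> arc_set (rail (\<not> b) i) \<union>
     arc_set (rail b (i + 1)) \<union> arc_set (rail (\<not> b) (i + 1)) \<union> arc_set (Rung (i + 1)))"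
    by (simp only: arc_rail[OF i'(1)] arc_rail[OF i'(2)] arc_set_rail[OF i'(1)] arc_set_rail[OF i'(2)]
        arc_set_rung[OF i'(3), of b])
  then show ?thesis
    by (cases b) (simp_all add: side_def crosses_commute Un_commute Un_left_commute)
qed

section \<open>Sweeping the ladder from left to right\<close>

definition edges_before :: "nat \<Rightarrow> ladder_edge set" where
  "edges_before i = {e \<in> edges (ladder g). ends (ladder g) e \<inter> columns (i - 1) \<noteq> {}}"

text \<open>Invariant of the sweep: the pair is on column \<open>i\<close>, and \<open>K\<close>
  holds the chips left behind. Vertical edges at column \<open>i\<close> are not among
  \<open>edges_before i\<close>, since the pair covers them on its own. Spare chips are not reserved
  in advance but added one per crossing.\<close>

definition sweeps :: "nat \<Rightarrow> 'v multiset \<Rightarrow> bool" where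
  "sweeps i K \<longleftrightarrow> set_mset K \<subseteq> verts G \<and>
    (\<forall>e\<in>edges_before i. \<forall>v\<in>arc_set e. covers G (add_mset (\<phi> (Bot i)) (add_mset (\<phi> (Top i)) K)) v)"

lemma covers_vertical:
  assumes e: "e \<in> edges (ladder g)" "ends (ladder g) e = {Bot i, Top i}" and v: "v \<in> arc_set e"
  shows "covers G (add_mset (\<phi> (Bot i)) (add_mset (\<phi> (Top i)) K)) v"
proof -
  have "v \<in> arc (Bot i) e ` {..len e}" using v arc_set_eq[OF e(1), of "Bot i"] e(2) by simp
  then obtain x where x: "x \<le> len e" "v = arc (Bot i) e x" by blast
  show ?thesis
    unfolding x(2) using arc_0[OF e] arc_len[OF e] x(1)
    by (intro covers_affine[OF affine_arc[OF e(1), of "Bot i"], of 0 x "len e" _ K]) auto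
qed

text \<open>The new configuration is equivalent to the old one with the spare chip \<open>s\<close>
  added, so everything covered before stays covered. The additional edges are vertical ones at
  column \<open>i\<close>, covered by the pair, or lie in the crossed region
  \<open>V\<close>.\<close>

lemma sweeps_advance:
  assumes K: "sweeps i K"
    and cross: "crosses G (\<phi> (Bot i)) (\<phi> (Top i)) (\<phi> (Bot j)) (\<phi> (Top j)) V"
    and V: "V \<subseteq> verts G"
    and i: "i \<in> {1..g - 1}"
    and before: "\<And>e. e \<in> edges_before j \<Longrightarrow>
      e \<in> edges_before i \<or> ends (ladder g) e = {Bot i, Top i} \<or> arc_set e \<subseteq> V"
  shows "\<exists>t. sweeps j (add_mset t K)"
proof -
  let ?x = "\<phi> (Bot i)" and ?y = "\<phi> (Top i)" and ?x' = "\<phi> (Bot j)" and ?y' = "\<phi> (Top j)"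
  obtain s t where s: "s \<in> V" and st: "chip_equiv G {#?x, ?y, s#} {#?x', ?y', t#}"
    and cov: "\<And>v. v \<in> V \<Longrightarrow> covers G {#?x, ?y, s#} v"
    using cross unfolding crosses_def by blast
  have "Bot i \<in> verts (ladder g)" "Top i \<in> verts (ladder g)" using i by (auto simp: ladder_def)
  then have "set_mset {#?x, ?y, s#} \<subseteq> verts G" using verts_G V s by auto
  then have t: "t \<in> verts G" using chip_equiv_verts[OF st] by simp
  let ?M = "add_mset ?x (add_mset ?y K)"
  have equiv: "chip_equiv G (add_mset ?x' (add_mset ?y' (add_mset t K))) (?M + {#s#})"
  proof -
    have "chip_equiv G ({#?x', ?y', t#} + K) ({#?x, ?y, s#} + K)"
      unfolding chip_equiv_add_right_iff using st by (rule chip_equiv_sym)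
    then show ?thesis by (simp add: add_mset_commute)
  qed
  have "covers G (add_mset ?x' (add_mset ?y' (add_mset t K))) v"
    if e: "e \<in> edges_before j" and v: "v \<in> arc_set e" for e v
  proof (rule covers_cong[OF equiv])
    from before[OF e] consider "e \<in> edges_before i" | "ends (ladder g) e = {Bot i, Top i}"
      | "arc_set e \<subseteq> V" by blast
    then show "covers G (?M + {#s#}) v"
    proof cases
      case 1
      then show ?thesis using K v by (intro covers_add) (auto simp: sweeps_def)
    next
      case 2
      then show ?thesis using e v by (intro covers_add covers_vertical) (auto simp: edges_before_def)
    next
      case 3
      have "covers G ({#?x, ?y, s#} + K) v" using 3 v by (intro covers_add cov) auto
      then show ?thesis by (simp add: add_mset_commute)
    qed
  qed
  then show ?thesis using K t by (auto simp: sweeps_def)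
qed

lemma edges_before_1: "edges_before 1 = {}"
  by (auto simp: edges_before_def columns_def)

lemma edges_before_Suc:
  assumes "e \<in> edges_before (i + 1)" "i \<in> {1..g - 2}"
  shows "e \<in> edges_before i \<or> ends (ladder g) e = {Bot i, Top i} \<or> e = rail False i \<or> e = rail True i"
  using assms by (cases e) (auto simp: edges_before_def columns_def ladder_def rail_def)

lemma ends_eq_column:
  assumes "e \<in> edges (ladder g)" "ends (ladder g) e = {Bot (i + 1), Top (i + 1)}"
    and "1 \<le> i" "i + 2 \<le> g - 1"
  shows "e = Rung (i + 1)"
  using assms by (cases e) (auto simp: ladder_def doubleton_eq_iff)

text \<open>Column 1 needs no spare chip, as no edge meets a column to its left; afterwards each
  spare chip advances the pair by two columns.\<close>

lemma sweeps_odd_column: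
  "2 * k + 1 \<le> g - 1 \<Longrightarrow> \<exists>K. size K = k \<and> sweeps (2 * k + 1) K"
proof (induction k)
  case 0
  show ?case by (intro exI[of _ "{#}"]) (simp add: sweeps_def edges_before_1[simplified])
next
  case (Suc k)
  let ?i = "2 * k + 1"
  obtain K where K: "size K = k" "sweeps ?i K" using Suc by auto
  have i: "1 \<le> ?i" "?i + 2 \<le> g - 1" using Suc.prems by auto
  have "\<exists>t. sweeps (?i + 2) (add_mset t K)"
  proof (rule sweeps_advance[OF K(2) crosses_two_cells[OF i]])
    show "?i \<in> {1..g - 1}" using i by auto
    show "arc_set (rail False ?i) \<union> arc_set (rail True ?i) \<union> arc_set (rail False (?i + 1)) \<union>
        arc_set (rail True (?i + 1)) \<union> arc_set (Rung (?i + 1)) \<subseteq> verts G"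
      using i by (intro Un_least arc_set_subset_verts rail_in_edges rung_in_edges) auto
    fix e assume e: "e \<in> edges_before (?i + 2)"
    then have "e \<in> edges_before ((?i + 1) + 1)" by simp
    moreover have "?i + 1 \<in> {1..g - 2}" "?i \<in> {1..g - 2}" using i by auto
    ultimately
    consider "e \<in> edges_before (?i + 1)" | "ends (ladder g) e = {Bot (?i + 1), Top (?i + 1)}"
      | "e = rail False (?i + 1)" | "e = rail True (?i + 1)" using edges_before_Suc by blast
    then show "e \<in> edges_before ?i \<or> ends (ladder g) e = {Bot ?i, Top ?i} \<or>
      arc_set e \<subseteq> arc_set (rail False ?i) \<union> arc_set (rail True ?i) \<union> arc_set (rail False (?i + 1)) \<union>
        arc_set (rail True (?i + 1)) \<union> arc_set (Rung (?i + 1))"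
    proof cases
      case 1
      from edges_before_Suc[OF this \<open>?i \<in> {1..g - 2}\<close>] show ?thesis by blast
    next
      case 2
      then have "e = Rung (?i + 1)" using e i by (intro ends_eq_column) (auto simp: edges_before_def)
      then show ?thesis by blast
    qed blast+
  qed
  then obtain t where "sweeps (?i + 2) (add_mset t K)" by blast
  then show ?case using K(1) by (intro exI[of _ "add_mset t K"]) (simp add: eval_nat_numeral)
qed

text \<open>If \<open>g - 1\<close> is odd, double steps from column 1 end there. Otherwise they end
  at column \<open>g - 2\<close>, and one more spare chip crosses the last cell.\<close>

lemma sweeps_last_column: "\<exists>K. size K = (g - 1) div 2 \<and> sweeps (g - 1) K"
proof (cases "odd (g - 1)")
  case True
  then have eq: "2 * ((g - 1) div 2) + 1 = g - 1" by (rule odd_two_times_div_two_succ)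
  from sweeps_odd_column[of "(g - 1) div 2"] show ?thesis unfolding eq by simp
next
  case False
  then have "even (g - 1)" by blast
  then obtain l where l: "g - 1 = 2 * l" by (rule evenE)
  \<comment> \<open>As \<open>g \<ge> 3\<close> forces \<open>l > 0\<close>, this gives
    \<open>g - 2 = 2 * k + 1\<close>: there are \<open>k\<close> double steps and one single
    step.\<close>
  define k where "k = l - 1"
  have k: "2 * k + 1 = g - 2" "(g - 1) div 2 = Suc k" "g - 2 + 1 = g - 1"
    using l g_ge_3 by (auto simp: k_def)
  have "2 * k + 1 \<le> g - 1" using k(1) by linarith
  from sweeps_odd_column[OF this] obtain K where K: "size K = k" "sweeps (g - 2) K"
    unfolding k(1) by blast
  have i: "g - 2 \<in> {1..g - 2}" using g_ge_3 by auto
  have "\<exists>t. sweeps (g - 2 + 1) (add_mset t K)"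
  proof (rule sweeps_advance[OF K(2) crosses_cell[OF i]])
    show "arc_set (rail False (g - 2)) \<union> arc_set (rail True (g - 2)) \<subseteq> verts G"
      using i by (intro Un_least arc_set_subset_verts rail_in_edges) auto
    show "g - 2 \<in> {1..g - 1}" using i by auto
    show "e \<in> edges_before (g - 2) \<or> ends (ladder g) e = {Bot (g - 2), Top (g - 2)} \<or>
        arc_set e \<subseteq> arc_set (rail False (g - 2)) \<union> arc_set (rail True (g - 2))"
      if "e \<in> edges_before (g - 2 + 1)" for e
      using edges_before_Suc[OF that i] by blast
  qed
  then obtain t where "sweeps (g - 1) (add_mset t K)" unfolding k(3) by blast
  then show ?thesis using K(1) k(2) by (intro exI[of _ "add_mset t K"]) simp
qed

lemma incident_edge:
  assumes "w \<in> verts (ladder g)"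
  shows "\<exists>e\<in>edges (ladder g). w \<in> ends (ladder g) e"
proof -
  from assms obtain b i where i: "i \<in> {1..g - 1}" "w = side b i" by (rule ladder_vertsE)
  show ?thesis
  proof (cases "i \<le> g - 2")
    case True
    then show ?thesis using i rail_in_edges[of i b] by (intro bexI[of _ "rail b i"]) (auto simp: ends_rail)
  next
    case False
    then have "i = g - 1" using i(1) by auto
    then show ?thesis
      using i by (intro bexI[of _ "RightEnd True"]) (auto simp: side_def ladder_def)
  qed
qed

lemma edge_cases:
  assumes "e \<in> edges (ladder g)"
  shows "e \<in> edges_before (g - 1) \<or> ends (ladder g) e = {Bot (g - 1), Top (g - 1)}"
  using assms g_ge_3 by (cases e) (auto simp: edges_before_def columns_def ladder_def)

text \<open>The pair on the last column covers the two right end edges, and all other edges are in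
  \<open>edges_before (g - 1)\<close>. The number of chips is
  \<open>2 + (g - 1) div 2 = (g + 3) div 2\<close>.\<close>

lemma rank_one_divisor:
  "\<exists>D. divisor G D \<and> degree G D = int ((g + 3) div 2) \<and> rank G D \<ge> 1"
proof -
  obtain K where K: "size K = (g - 1) div 2" "sweeps (g - 1) K" using sweeps_last_column by blast
  let ?M = "add_mset (\<phi> (Bot (g - 1))) (add_mset (\<phi> (Top (g - 1))) K)"
  have M: "set_mset ?M \<subseteq> verts G"
    using K(2) g_ge_3 side_in_verts[of "g - 1" False] side_in_verts[of "g - 1" True] verts_G
    by (auto simp: sweeps_def side_def)
  have "rank G (chips ?M) \<ge> 1"
  proof (rule rank_ge_one[OF M])
    fix v assume "v \<in> verts G"
    then obtain e a i where e: "e \<in> edges (ladder g)" "a \<in> ends (ladder g) e" "i \<le> len e" "v = arc a e i"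
      using covered_by_arc incident_edge by metis
    then have v: "v \<in> arc_set e" by (auto simp: arc_set_def)
    from edge_cases[OF e(1)] show "covers G ?M v"
    proof
      assume "e \<in> edges_before (g - 1)"
      then show ?thesis using K(2) v by (auto simp: sweeps_def)
    next
      assume "ends (ladder g) e = {Bot (g - 1), Top (g - 1)}"
      then show ?thesis using covers_vertical e(1) v by blast
    qed
  qed
  moreover have "degree G (chips ?M) = int ((g + 3) div 2)"
    using degree_chips[OF M] K(1) g_ge_3 by simp
  moreover have "divisor G (chips ?M)"
    using M by (auto simp: divisor_def chips_def count_eq_zero_iff)
  ultimately show ?thesis by blast
qed

end

section \<open>From a given subdivision to the theorem\<close>

lemma ladder_ends_properties:
  assumes "g \<ge> 3" "e \<in> edges (ladder g)"
  shows "card (ends (ladder g) e) = 2" "ends (ladder g) e \<subseteq> verts (ladder g)"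
  using assms by (cases e; auto simp: ladder_def)+

lemma ladder_subdivision_exists:
  fixes G :: "('v, 'e) mgraph"
  assumes "g \<ge> 3" and "multigraph G" and "is_subdivision (ladder g) G"
  shows "\<exists>n \<phi> p q. ladder_subdivision G g n \<phi> p q"
  using assms(3) unfolding is_subdivision_def
proof (elim ex_forward conjE)
  fix n :: "ladder_edge \<Rightarrow> nat" and \<phi> :: "ladder_vertex \<Rightarrow> 'v" and p q
  assume *: "inj_on \<phi> (verts (ladder g))"
    "inj_on (\<lambda>(e, i). p e i) (SIGMA e:edges (ladder g). {1..n e})"
    "\<phi> ` verts (ladder g) \<inter> (\<lambda>(e, i). p e i) ` (SIGMA e:edges (ladder g). {1..n e}) = {}"
    "verts G = \<phi> ` verts (ladder g) \<union> (\<lambda>(e, i). p e i) ` (SIGMA e:edges (ladder g). {1..n e})"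
    "bij_betw (\<lambda>(e, i). q e i) (SIGMA e:edges (ladder g). {0..n e}) (edges G)"
    "\<forall>e\<in>edges (ladder g). {p e 0, p e (n e + 1)} = \<phi> ` ends (ladder g) e"
    "\<forall>e\<in>edges (ladder g). \<forall>i\<in>{0..n e}. ends G (q e i) = {p e i, p e (i + 1)}"
  interpret multigraph G by fact
  show "ladder_subdivision G g n \<phi> p q"
  proof
    show "finite (edges (ladder g))" by (simp add: ladder_def)
    fix e assume e: "e \<in> edges (ladder g)"
    show "card (ends (ladder g) e) = 2" "ends (ladder g) e \<subseteq> verts (ladder g)"
      using ladder_ends_properties[OF assms(1) e] .
    show "{p e 0, p e (n e + 1)} = \<phi> ` ends (ladder g) e" using *(6) e by (rule bspec)
    show "ends G (q e i) = {p e i, p e (i + 1)}" if "i \<in> {0..n e}" for i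
      using bspec[OF bspec[OF *(7) e] that] .
  qed (fact * assms(1))+
qed

theorem theorem6p2p2:
  fixes G :: "('v, 'e) mgraph" and g :: nat
  assumes "g \<ge> 3"
    and "multigraph G"
    and "is_subdivision (ladder g) G"
  shows "\<exists>D. divisor G D \<and> degree G D = int ((g + 3) div 2) \<and> rank G D \<ge> 1"
proof -
  obtain n \<phi> p q where "ladder_subdivision G g n \<phi> p q"
    using ladder_subdivision_exists[OF assms] by blast
  then interpret ladder_subdivision G g n \<phi> p q .
  show ?thesis by (rule rank_one_divisor)
qed

end
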